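(* Let $G$ be an $H$-type group with structure matrices $U^{(1)},\dots,U^{(m)}$, let $\lambda\in\mathbb R^m\setminus\{0\}$ and $r\ge0$. Suppose $f$ is a continuous function on $\mathbb C^n$ such that $|z|^ke^{\frac{|\lambda|}4|z|^2}f(z)$ is bounded for each $k\in\mathbb Z_+$. Then $f$ is supported in $|z|\le r$ if and only if $f\times_\lambda\mu_s(z)=0$ for all $z\in\mathbb C^n$ and $s>r+|z|$.
   Context: $\mathbb Z_+$ is the set of non-negative integers. $U^{(1)},\dots,U^{(m)}$ are real skew-symmetric orthogonal $2n\times2n$ matrices with $U^{(j)}U^{(l)}+U^{(l)}U^{(j)}=0$ for $j\ne l$; the $H$-type group is $\mathbb R^{2n}\times\mathbb R^m$ with law $(x,t)(\xi,\tau)=(x+\xi,(t_j+\tau_j+\frac12\langle x,U^{(j)}\xi\rangle)_j)$. Identify $x=(x_1,\dots,x_n,y_1,\dots,y_n)\in\mathbb R^{2n}$ with its complexification $z=(x_1+iy_1,\dots,x_n+iy_n)\in\mathbb C^n$; $U^{(j)}w$ denotes the complexification of $U^{(j)}\xi$ if $w$ is that of $\xi$, and $z\cdot w=\sum_jz_jw_j$. With $\mu_s$ the normalized surface measure on $\{|w|=s\}\subset\mathbb C^n$, the $\lambda$-twisted spherical mean is $$f\times_\lambda\mu_s(z)=\int_{|w|=s}f(z-w)\,e^{\frac i2\sum_{j=1}^m\lambda_j\mathrm{Re}(z\cdot\overline{U^{(j)}w})}\,d\mu_s(w).$$ *)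

theory Defs
  imports "HOL-Analysis.Analysis" "HOL-Algebra.Group"
begin

text \<open>The index type \<open>'n + 'n\<close> of \<open>\<real>\<^sup>2\<^sup>n\<close> splits the coordinates as
  \<open>(x\<^sub>1, \<dots>, x\<^sub>n, y\<^sub>1, \<dots>, y\<^sub>n)\<close>: \<open>Inl j\<close> is the \<open>x\<^sub>j\<close> slot and \<open>Inr j\<close> the \<open>y\<^sub>j\<close> slot.\<close>

definition complexify :: "real ^ ('n::finite + 'n) \<Rightarrow> complex ^ 'n"
  where "complexify x = (\<chi> j. Complex (x $ Inl j) (x $ Inr j))"

definition realify :: "complex ^ 'n::finite \<Rightarrow> real ^ ('n + 'n)"
  where "realify z = (\<chi> k. case k of Inl j \<Rightarrow> Re (z $ j) | Inr j \<Rightarrow> Im (z $ j))"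

lemma complexify_realify [simp]: "complexify (realify z) = z"
  by (simp add: complexify_def realify_def vec_eq_iff)

lemma realify_complexify [simp]: "realify (complexify x) = x"
  by (auto simp: complexify_def realify_def vec_eq_iff split: sum.split)

definition complex_action :: "real ^ ('n::finite + 'n) ^ ('n + 'n) \<Rightarrow> complex ^ 'n \<Rightarrow> complex ^ 'n"
  where "complex_action U w = complexify (U *v realify w)"

text \<open>The bilinear product on \<open>\<complex>\<^sup>n\<close>, without conjugation.\<close>

definition cdot :: "complex ^ 'n::finite \<Rightarrow> complex ^ 'n \<Rightarrow> complex"
  where "cdot z w = (\<Sum>j\<in>UNIV. z $ j * w $ j)"

definition vec_cnj :: "complex ^ 'n::finite \<Rightarrow> complex ^ 'n"
  where "vec_cnj z = (\<chi> j. cnj (z $ j))"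

definition htype_matrices :: "('m::finite \<Rightarrow> real ^ ('n::finite + 'n) ^ ('n + 'n)) \<Rightarrow> bool"
  where "htype_matrices U \<longleftrightarrow>
    (\<forall>j. transpose (U j) = - U j \<and> orthogonal_matrix (U j)) \<and>
    (\<forall>j l. j \<noteq> l \<longrightarrow> U j ** U l + U l ** U j = 0)"

definition htype_law ::
  "('m::finite \<Rightarrow> real ^ ('n::finite + 'n) ^ ('n + 'n)) \<Rightarrow>
    (real ^ ('n + 'n)) \<times> (real ^ 'm) \<Rightarrow> (real ^ ('n + 'n)) \<times> (real ^ 'm) \<Rightarrow>
    (real ^ ('n + 'n)) \<times> (real ^ 'm)"
  where "htype_law U = (\<lambda>(x, t) (\<xi>, \<tau>).
    (x + \<xi>, \<chi> j. t $ j + \<tau> $ j + (1/2) * (x \<bullet> (U j *v \<xi>))))"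

definition htype_group ::
  "((real ^ ('n::finite + 'n)) \<times> (real ^ 'm::finite)) monoid \<Rightarrow>
    ('m \<Rightarrow> real ^ ('n + 'n) ^ ('n + 'n)) \<Rightarrow> bool"
  where "htype_group G U \<longleftrightarrow>
    htype_matrices U \<and> G = \<lparr>carrier = UNIV, mult = htype_law U, one = (0, 0)\<rparr>"

lemma htype_group_is_group:
  assumes "htype_group G U"
  shows "group G"
proof -
  have G: "G = \<lparr>carrier = UNIV, mult = htype_law U, one = (0, 0)\<rparr>"
    and skew: "transpose (U j) = - U j" for j
    using assms by (auto simp: htype_group_def htype_matrices_def)
  have zero: "x \<bullet> (U j *v x) = 0" for x j
  proof -
    have "x \<bullet> (U j *v x) = (transpose (U j) *v x) \<bullet> x"
      by (simp add: dot_lmul_matrix transpose_matrix_vector)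
    also have "\<dots> = - (x \<bullet> (U j *v x))"
    proof -
      have "(- U j) *v x = - (U j *v x)"
        by (simp add: matrix_vector_mult_def vec_eq_iff sum_negf)
      then show ?thesis by (simp add: skew inner_commute)
    qed
    finally show ?thesis by simp
  qed
  show ?thesis
  proof (rule groupI)
    fix a assume "a \<in> carrier G"
    show "\<exists>b\<in>carrier G. b \<otimes>\<^bsub>G\<^esub> a = \<one>\<^bsub>G\<^esub>"
      by (rule bexI[of _ "(- fst a, - snd a)"])
        (auto simp: G htype_law_def zero vec_eq_iff split: prod.splits)
  qed (auto simp: G htype_law_def matrix_vector_right_distrib inner_left_distrib
      inner_right_distrib vec_eq_iff algebra_simps add_divide_distrib split: prod.splits)
qed

text \<open>Surface measure of the sphere \<open>{|w| = s}\<close> in \<open>d\<close> dimensions, as given by polar coordinates: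
  a Borel part \<open>E\<close> has area \<open>d s\<^sup>d\<^sup>-\<^sup>1\<close> times the Lebesgue volume of the cone
  \<open>{\<rho> w / s | w \<in> E, 0 < \<rho> < 1}\<close>, i.e. of the preimage of \<open>E\<close> in the unit ball under
  radial projection. The measure lives on the Borel sets of the ambient space.\<close>

definition sphere_surface_measure :: "real \<Rightarrow> 'a::euclidean_space measure"
  where "sphere_surface_measure s =
    scale_measure (ennreal (real DIM('a) * s ^ (DIM('a) - 1)))
      (distr (restrict_space lborel (ball 0 1 - {0})) borel (\<lambda>w. (s / norm w) *\<^sub>R w))"

definition normalized_sphere_measure :: "real \<Rightarrow> 'a::euclidean_space measure"
  where "normalized_sphere_measure s = uniform_measure (sphere_surface_measure s) (sphere 0 s)"

lemma normalized_sphere_measure_sphere: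
  assumes "s > 0"
  shows "emeasure (normalized_sphere_measure s) (sphere (0::'a::euclidean_space) s) = 1"
proof -
  let ?B = "ball (0::'a) 1 - {0}" and ?S = "sphere (0::'a) s"
  let ?p = "\<lambda>w::'a. (s / norm w) *\<^sub>R w"
  have S: "?S \<in> sets borel"
    by simp
  have meas: "?p \<in> measurable (restrict_space lborel ?B) borel"
    by (rule measurable_restrict_space1) measurable
  have "?p -` ?S \<inter> ?B = ?B"
    using assms by auto
  then have "emeasure (distr (restrict_space lborel ?B) borel ?p) ?S = emeasure lborel ?B"
    by (subst emeasure_distr[OF meas S]) (simp_all add: space_restrict_space emeasure_restrict_space)
  also have "\<dots> = emeasure lborel (ball (0::'a) 1)"
    by (rule emeasure_Diff_null_set) auto
  finally have E: "emeasure (sphere_surface_measure s) ?S =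
      ennreal (real DIM('a) * s ^ (DIM('a) - 1)) * emeasure lborel (ball (0::'a) 1)"
    by (simp add: sphere_surface_measure_def)
  have "emeasure lborel (ball (0::'a) 1) \<noteq> 0"
    using less_imp_neq[OF unit_ball_vol_pos[of "real DIM('a)", OF of_nat_0_le_iff], symmetric]
    by (simp add: emeasure_ball del: unit_ball_vol_pos)
  moreover have "emeasure lborel (ball (0::'a) 1) \<noteq> \<infinity>"
    using emeasure_bounded_finite[OF bounded_ball, of "0::'a" 1] by simp
  ultimately have "emeasure (sphere_surface_measure s) ?S \<noteq> 0"
      "emeasure (sphere_surface_measure s) ?S \<noteq> \<infinity>"
    using assms by (auto simp: E ennreal_mult_eq_top_iff)
  then show ?thesis
    unfolding normalized_sphere_measure_def
    by (subst emeasure_uniform_measure)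
      (auto simp: sphere_surface_measure_def ennreal_divide_self top.not_eq_extremum)
qed

definition twisted_spherical_mean ::
  "('m::finite \<Rightarrow> real ^ ('n::finite + 'n) ^ ('n + 'n)) \<Rightarrow> real ^ 'm \<Rightarrow>
    (complex ^ 'n \<Rightarrow> complex) \<Rightarrow> real \<Rightarrow> complex ^ 'n \<Rightarrow> complex"
  where "twisted_spherical_mean U lam f s z =
    (LINT w|normalized_sphere_measure s.
      f (z - w) *
      exp (\<i> / 2 * complex_of_real
        (\<Sum>j\<in>UNIV. lam $ j * Re (cdot z (vec_cnj (complex_action (U j) w))))))"

end

theory Submission
  imports Defs
begin

text \<open>If \<open>f\<close> is supported in \<open>|z| \<le> r\<close> and \<open>s > r + |z|\<close>, then \<open>z - w\<close> with \<open>|w| = s\<close> lies outside the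
  support, so the integrand is zero (by the formula \<open>twisted_spherical_mean_eq\<close>). The converse is
  the substance.

  Put \<open>a = |\<lambda>| / 2\<close> and \<open>J = |\<lambda>|\<^sup>-\<^sup>1 \<Sum>\<^sub>j \<lambda>\<^sub>j U\<^sub>j\<close>. The relations between the \<open>U\<^sub>j\<close> make \<open>J\<close> an orthogonal complex
  structure, and the means of \<open>f\<close> become integrals of \<open>f u\<close> against \<open>exp (\<i> a \<langle>J z, u\<rangle>)\<close> over spheres
  around \<open>z\<close>. Integrating over the radius (\<open>integral_eq_0_if_sphere_integrals_eq_0\<close>), the hypothesis
  says that these integrals vanish with the spherical measure replaced by any profile
  \<open>\<phi> (|u - z|\<^sup>2)\<close> that is supported outside a sphere enclosing the ball of radius \<open>r\<close>
  and grows slower than \<open>exp (a t / 2)\<close>.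

  As in the classical proof for Euclidean spherical means, the centre \<open>z\<close> is differentiated in order
  to insert polynomial factors. Here one differentiates with the Cauchy-Riemann operators of \<open>J\<close>:
  they insert a holomorphic (\<open>\<sigma> = 1\<close>) or antiholomorphic (\<open>\<sigma> = -1\<close>) linear form in \<open>u - z\<close> and
  change the profile into \<open>\<sigma> a \<phi> - 2 \<phi>'\<close> (\<open>twisted_integral_mult_form\<close>). For \<open>\<sigma> = -1\<close> this operation on
  profiles is onto, so \<open>f\<close> times an antiholomorphic form satisfies the hypothesis again
  (\<open>exterior_null_mult_form\<close>). For \<open>\<sigma> = 1\<close> it is not onto: on each sphere family a multiple of the
  Gaussian \<open>exp (- a |u - z|\<^sup>2 / 2)\<close>, times a polynomial in \<open>|u - z|\<^sup>2\<close>, could survive. At \<open>z = 0\<close> this is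
  excluded by the decay of \<open>f\<close>, which is faster than that Gaussian by every power; there a limit
  of profiles of critical growth is allowed (\<open>hol_moment_zero\<close>).

  Hence every product of linear forms integrates to zero against \<open>f u (|u|\<^sup>2 - s)\<^sub>+ exp (a |u|\<^sup>2 / 2)\<close>, for
  every \<open>s > r\<^sup>2\<close>. Second differences in \<open>s\<close> localize this to spherical shells, and the Weierstrass
  approximation theorem gives \<open>f = 0\<close> there (\<open>vanishes_outside_ball\<close>).\<close>

section \<open>Polar coordinates\<close>

text \<open>The map \<open>(\<rho>, w) \<mapsto> (\<rho> / |w|) w\<close> covers the space by spheres, each one parametrized by the punctured
  unit ball; \<open>polar_density\<close> is the density on the pairs whose image is Lebesgue measure. The ball
  replaces the unit sphere, so no surface measure has to be constructed.\<close>

definition polar_density :: "real \<Rightarrow> 'a::euclidean_space \<Rightarrow> real"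
  where "polar_density \<rho> w =
    real DIM('a) * \<rho> ^ (DIM('a) - 1) * indicator {0<..} \<rho> * indicator (ball 0 1 - {0}) w"

lemma polar_density_measurable [measurable]:
  "case_prod polar_density \<in> borel_measurable (borel \<Otimes>\<^sub>M (borel :: 'a::euclidean_space measure))"
proof -
  have "polar_density = (\<lambda>\<rho> (w::'a). real DIM('a) * \<rho> ^ (DIM('a) - 1) *
      (if 0 < \<rho> then 1 else 0) * (if norm w < 1 then 1 else 0) * (if w = 0 then 0 else 1))"
    by (auto simp: polar_density_def fun_eq_iff indicator_def)
  then show ?thesis by (rule ssubst) measurable
qed

lemma polar_density_nonneg [simp]: "0 \<le> polar_density \<rho> w"
  by (simp add: polar_density_def indicator_def)

lemma nn_integral_lborel_scale:
  fixes g :: "'a::euclidean_space \<Rightarrow> ennreal"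
  assumes [measurable]: "g \<in> borel_measurable borel" and c: "c > 0"
  shows "(\<integral>\<^sup>+v. g v \<partial>lborel) = ennreal (c ^ DIM('a)) * (\<integral>\<^sup>+w. g (c *\<^sub>R w) \<partial>lborel)"
  by (subst lborel_affine[of c "0::'a"])
     (use c in \<open>simp_all add: nn_integral_density nn_integral_distr nn_integral_cmult\<close>)

lemma nn_integral_inverse_power:
  assumes "x > 0" "d > 0"
  shows "(\<integral>\<^sup>+\<sigma>. ennreal (real d * x ^ d / \<sigma> ^ Suc d) * indicator {x<..} \<sigma> \<partial>lborel) = 1"
proof -
  have "(\<integral>\<^sup>+\<sigma>. ennreal (real d * x ^ d / \<sigma> ^ Suc d) * indicator {x<..} \<sigma> \<partial>lborel) =
      (\<integral>\<^sup>+\<sigma>. ennreal (real d * x ^ d / \<sigma> ^ Suc d) * indicator {x..} \<sigma> \<partial>lborel)"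
    by (rule nn_integral_cong_AE, rule AE_mp[OF AE_lborel_singleton[of x]])
       (auto simp: indicator_def)
  also have "\<dots> = ennreal (0 - (- (x ^ d / x ^ d)))"
  proof (rule nn_integral_FTC_atLeast[where F = "\<lambda>\<sigma>. - (x ^ d / \<sigma> ^ d)"])
    show "((\<lambda>\<sigma>. - (x ^ d / \<sigma> ^ d)) \<longlongrightarrow> 0) at_top"
    proof -
      have "filterlim (\<lambda>\<sigma>::real. \<sigma> ^ d) at_infinity at_top"
        using filterlim_at_top_imp_at_infinity filterlim_pow_at_top[OF \<open>d > 0\<close> filterlim_ident] by blast
      then have "((\<lambda>\<sigma>. - (x ^ d / \<sigma> ^ d)) \<longlongrightarrow> - 0) at_top"
        by (intro tendsto_minus tendsto_divide_0[OF tendsto_const])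
      then show ?thesis by simp
    qed
    fix \<sigma> assume s: "x \<le> \<sigma>"
    with assms have "\<sigma> > 0" by simp
    then show "((\<lambda>\<sigma>. - (x ^ d / \<sigma> ^ d)) has_real_derivative real d * x ^ d / \<sigma> ^ Suc d) (at \<sigma>)"
      using assms power_minus_mult[of _ \<sigma>]
      by (cases d) (auto intro!: derivative_eq_intros simp: field_simps, metis gr0I)
    show "0 \<le> real d * x ^ d / \<sigma> ^ Suc d" using assms \<open>\<sigma> > 0\<close> by simp
  qed simp
  also have "\<dots> = 1" using assms by simp
  finally show ?thesis .
qed

text \<open>Polar coordinates come from Tonelli's theorem and scaling alone. For fixed \<open>w\<close> the substitution
  \<open>\<rho> = |w| \<sigma>\<close> turns \<open>(\<rho> / |w|) w\<close> into \<open>\<sigma> w\<close>; for fixed \<open>\<sigma>\<close> the substitution \<open>v = \<sigma> w\<close> then leaves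
  \<open>g v\<close> with the weight \<open>d |v|\<^sup>d \<sigma>\<^sup>-\<^sup>d\<^sup>-\<^sup>1\<close> on \<open>\<sigma> > |v|\<close>, whose integral over \<open>\<sigma>\<close> is \<open>1\<close>.\<close>

lemma nn_integral_polar:
  fixes g :: "'a::euclidean_space \<Rightarrow> ennreal"
  assumes [measurable]: "g \<in> borel_measurable borel"
  shows "(\<integral>\<^sup>+\<rho>. \<integral>\<^sup>+w. ennreal (polar_density \<rho> w) * g ((\<rho> / norm w) *\<^sub>R w) \<partial>lborel \<partial>lborel)
    = (\<integral>\<^sup>+u. g u \<partial>lborel)"
proof -
  let ?d = "DIM('a)"
  have d: "?d > 0" by simp
  define k where "k \<sigma> v = ennreal (real ?d * norm v ^ ?d / \<sigma> ^ Suc ?d) * indicator {norm v<..} \<sigma> *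
      indicator {0<..} \<sigma> * indicator (- {0}) v * g v" for \<sigma> and v :: 'a
  have [measurable]: "case_prod k \<in> borel_measurable (borel \<Otimes>\<^sub>M borel)"
  proof -
    have "k = (\<lambda>\<sigma> v. ennreal (real ?d * norm v ^ ?d / \<sigma> ^ Suc ?d) * (if norm v < \<sigma> then 1 else 0) *
      indicator {0<..} \<sigma> * indicator (- {0}) v * g v)"
      by (auto simp: k_def fun_eq_iff indicator_def)
    then show ?thesis by simp
  qed
  have "(\<integral>\<^sup>+\<rho>. \<integral>\<^sup>+w. ennreal (polar_density \<rho> w) * g ((\<rho> / norm w) *\<^sub>R w) \<partial>lborel \<partial>lborel)
      = (\<integral>\<^sup>+w. \<integral>\<^sup>+\<rho>. ennreal (polar_density \<rho> w) * g ((\<rho> / norm w) *\<^sub>R w) \<partial>lborel \<partial>(lborel :: 'a measure))"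
    by (rule lborel_pair.Fubini') measurable
  also have "\<dots> = (\<integral>\<^sup>+w. \<integral>\<^sup>+\<sigma>. ennreal (\<sigma> ^ ?d) * k \<sigma> (\<sigma> *\<^sub>R w) \<partial>lborel \<partial>lborel)"
  proof (rule nn_integral_cong)
    fix w :: 'a
    show "(\<integral>\<^sup>+\<rho>. ennreal (polar_density \<rho> w) * g ((\<rho> / norm w) *\<^sub>R w) \<partial>lborel)
      = (\<integral>\<^sup>+\<sigma>. ennreal (\<sigma> ^ ?d) * k \<sigma> (\<sigma> *\<^sub>R w) \<partial>lborel)"
    proof (cases "w = 0")
      case True
      then show ?thesis by (simp add: polar_density_def k_def)
    next
      case False
      have "(\<integral>\<^sup>+\<rho>. ennreal (polar_density \<rho> w) * g ((\<rho> / norm w) *\<^sub>R w) \<partial>lborel)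
        = ennreal \<bar>norm w\<bar> * (\<integral>\<^sup>+\<sigma>. ennreal (polar_density (0 + norm w * \<sigma>) w) *
            g (((0 + norm w * \<sigma>) / norm w) *\<^sub>R w) \<partial>lborel)"
        using False by (subst nn_integral_real_affine[where c = "norm w" and t = 0]) simp_all
      also have "\<dots> = (\<integral>\<^sup>+\<sigma>. ennreal (norm w) * (ennreal (polar_density (norm w * \<sigma>) w) *
            g (\<sigma> *\<^sub>R w)) \<partial>lborel)"
        using False by (subst nn_integral_cmult) simp_all
      also have "\<dots> = (\<integral>\<^sup>+\<sigma>. ennreal (\<sigma> ^ ?d) * k \<sigma> (\<sigma> *\<^sub>R w) \<partial>lborel)"
      proof (rule nn_integral_cong)
        fix \<sigma> :: real
        show "ennreal (norm w) * (ennreal (polar_density (norm w * \<sigma>) w) * g (\<sigma> *\<^sub>R w))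
          = ennreal (\<sigma> ^ ?d) * k \<sigma> (\<sigma> *\<^sub>R w)"
        proof (cases "\<sigma> > 0 \<and> norm w < 1")
          case True
          then have s: "\<sigma> > 0" "norm w < 1" by auto
          obtain e where e: "?d = Suc e" using d by (cases ?d) auto
          have "norm w * polar_density (norm w * \<sigma>) w
              = \<sigma> ^ ?d * (real ?d * norm (\<sigma> *\<^sub>R w) ^ ?d / \<sigma> ^ Suc ?d)"
            using s False unfolding polar_density_def e
            by (simp add: zero_less_mult_iff indicator_def power_mult_distrib field_simps)
          then have "ennreal (norm w) * ennreal (polar_density (norm w * \<sigma>) w)
              = ennreal (\<sigma> ^ ?d) * ennreal (real ?d * norm (\<sigma> *\<^sub>R w) ^ ?d / \<sigma> ^ Suc ?d)"
            using s by (simp flip: ennreal_mult'')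
          moreover have "k \<sigma> (\<sigma> *\<^sub>R w) = ennreal (real ?d * norm (\<sigma> *\<^sub>R w) ^ ?d / \<sigma> ^ Suc ?d) * g (\<sigma> *\<^sub>R w)"
            using s False by (simp add: k_def indicator_def)
          ultimately show ?thesis by (metis mult.assoc)
        next
          case c: False
          show ?thesis
          proof (cases "\<sigma> > 0")
            case True
            with c have "\<not> norm w < 1" by simp
            then show ?thesis
              using True by (simp add: polar_density_def k_def indicator_def)
          next
            case s: False
            then have "\<not> 0 < norm w * \<sigma>" using False by (simp add: zero_less_mult_iff)
            then show ?thesis
              using s by (simp add: polar_density_def k_def indicator_def)
          qed
        qed
      qed
      finally show ?thesis .
    qed
  qed
  also have "\<dots> = (\<integral>\<^sup>+\<sigma>. \<integral>\<^sup>+w. ennreal (\<sigma> ^ ?d) * k \<sigma> (\<sigma> *\<^sub>R w) \<partial>(lborel :: 'a measure) \<partial>lborel)"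
    by (rule lborel_pair.Fubini'[symmetric]) measurable
  also have "\<dots> = (\<integral>\<^sup>+\<sigma>. \<integral>\<^sup>+v. k \<sigma> v \<partial>lborel \<partial>lborel)"
  proof (rule nn_integral_cong)
    fix \<sigma> :: real
    show "(\<integral>\<^sup>+w. ennreal (\<sigma> ^ ?d) * k \<sigma> (\<sigma> *\<^sub>R w) \<partial>lborel) = (\<integral>\<^sup>+v. k \<sigma> v \<partial>lborel)"
    proof (cases "\<sigma> > 0")
      case True
      then show ?thesis
        by (subst nn_integral_lborel_scale[of "k \<sigma>" \<sigma>]) (simp_all add: nn_integral_cmult)
    next
      case False
      then show ?thesis by (simp add: k_def)
    qed
  qed
  also have "\<dots> = (\<integral>\<^sup>+v. \<integral>\<^sup>+\<sigma>. k \<sigma> v \<partial>lborel \<partial>lborel)"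
    by (rule lborel_pair.Fubini') measurable
  also have "\<dots> = (\<integral>\<^sup>+v. g v \<partial>lborel)"
  proof (rule nn_integral_cong_AE, rule AE_mp[OF AE_lborel_singleton[of 0]], rule AE_I2, rule impI)
    fix v :: 'a assume v: "v \<noteq> 0"
    have "(\<integral>\<^sup>+\<sigma>. k \<sigma> v \<partial>lborel)
      = (\<integral>\<^sup>+\<sigma>. (ennreal (real ?d * norm v ^ ?d / \<sigma> ^ Suc ?d) * indicator {norm v<..} \<sigma>) * g v \<partial>lborel)"
      by (rule nn_integral_cong) (use v order.strict_trans1[OF norm_ge_zero[of v]] in \<open>auto simp: k_def indicator_def\<close>)
    also have "\<dots> = g v"
      using nn_integral_inverse_power[of "norm v" ?d] v by (subst nn_integral_multc) simp_all
    finally show "(\<integral>\<^sup>+\<sigma>. k \<sigma> v \<partial>lborel) = g v" .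
  qed
  finally show ?thesis .
qed

text \<open>The same formula as an identity of measures, which makes Fubini's theorem available for
  integrands that are not nonnegative.\<close>

lemma distr_polar:
  "distr (density (lborel \<Otimes>\<^sub>M lborel) (\<lambda>(\<rho>, w). ennreal (polar_density \<rho> w))) borel
     (\<lambda>(\<rho>, w). (\<rho> / norm w) *\<^sub>R w) = (lborel :: 'a::euclidean_space measure)"
proof (rule measure_eqI)
  fix A assume "A \<in> sets (distr (density (lborel \<Otimes>\<^sub>M lborel)
    (\<lambda>(\<rho>, w). ennreal (polar_density \<rho> w))) borel (\<lambda>(\<rho>, w). (\<rho> / norm w) *\<^sub>R (w::'a)))"
  then have A [measurable]: "A \<in> sets borel" by simp
  let ?M = "density (lborel \<Otimes>\<^sub>M lborel) (\<lambda>(\<rho>, w). ennreal (polar_density \<rho> (w::'a)))"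
  let ?q = "\<lambda>(\<rho>, w::'a). (\<rho> / norm w) *\<^sub>R w"
  have "emeasure (distr ?M borel ?q) A = (\<integral>\<^sup>+x. indicator A x \<partial>distr ?M borel ?q)"
    by simp
  also have "\<dots> = (\<integral>\<^sup>+x. indicator A (?q x) \<partial>?M)"
    by (rule nn_integral_distr) simp_all
  also have "\<dots> = (\<integral>\<^sup>+x. (\<lambda>(\<rho>, w). ennreal (polar_density \<rho> w)) x * indicator A (?q x) \<partial>(lborel \<Otimes>\<^sub>M lborel))"
    by (rule nn_integral_density) simp_all
  also have "\<dots> = (\<integral>\<^sup>+\<rho>. \<integral>\<^sup>+w. ennreal (polar_density \<rho> w) * indicator A ((\<rho> / norm w) *\<^sub>R w)
      \<partial>lborel \<partial>lborel)"
    by (subst lborel.nn_integral_fst[symmetric]) simp_all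
  also have "\<dots> = (\<integral>\<^sup>+u. indicator A u \<partial>lborel)"
    by (rule nn_integral_polar) simp
  finally show "emeasure (distr ?M borel ?q) A = emeasure lborel A" by simp
qed simp

lemma integral_eq_0_if_sphere_integrals_eq_0:
  fixes F :: "'a::euclidean_space \<Rightarrow> 'b::{banach, second_countable_topology}"
  assumes F: "integrable lborel F"
    and zero: "\<And>\<rho>. \<rho> > 0 \<Longrightarrow> (LINT w:ball 0 1 - {0}|lborel. F ((\<rho> / norm w) *\<^sub>R w)) = 0"
  shows "integral\<^sup>L lborel F = 0"
proof -
  let ?M = "density (lborel \<Otimes>\<^sub>M lborel) (\<lambda>(\<rho>, w). ennreal (polar_density \<rho> (w::'a)))"
  let ?q = "\<lambda>(\<rho>, w::'a). (\<rho> / norm w) *\<^sub>R w"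
  have [measurable]: "F \<in> borel_measurable borel"
    using borel_measurable_integrable[OF F] by simp
  have "integrable (distr ?M borel ?q) F"
    using F by (simp add: distr_polar)
  then have "integrable ?M (\<lambda>x. F (?q x))"
    by (subst (asm) integrable_distr_eq) simp_all
  then have int: "integrable (lborel \<Otimes>\<^sub>M lborel) (\<lambda>x. (case x of (\<rho>, w) \<Rightarrow> polar_density \<rho> w) *\<^sub>R F (?q x))"
    by (subst integrable_density[symmetric]) (auto simp: split_beta')
  have "integral\<^sup>L lborel F = integral\<^sup>L (distr ?M borel ?q) F"
    by (simp add: distr_polar)
  also have "\<dots> = integral\<^sup>L ?M (\<lambda>x. F (?q x))"
    by (rule integral_distr) simp_all
  also have "\<dots> = integral\<^sup>L (lborel \<Otimes>\<^sub>M lborel) (\<lambda>x. (case x of (\<rho>, w) \<Rightarrow> polar_density \<rho> w) *\<^sub>R F (?q x))"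
    by (subst integral_density[symmetric]) (auto simp: split_beta')
  also have "\<dots> = (LINT \<rho>|lborel. LINT w|lborel. polar_density \<rho> w *\<^sub>R F ((\<rho> / norm w) *\<^sub>R w))"
    using lborel_pair.integral_fst'[OF int] by simp
  also have "\<dots> = (LINT \<rho>|(lborel :: real measure). 0)"
  proof (rule Bochner_Integration.integral_cong[OF refl])
    fix \<rho> :: real
    show "(LINT w|lborel. polar_density \<rho> w *\<^sub>R F ((\<rho> / norm w) *\<^sub>R w)) = 0"
    proof (cases "\<rho> > 0")
      case True
      have "(LINT w|lborel. polar_density \<rho> w *\<^sub>R F ((\<rho> / norm w) *\<^sub>R w)) =
          (LINT w|lborel. (real DIM('a) * \<rho> ^ (DIM('a) - 1)) *\<^sub>R
             indicator (ball 0 1 - {0}) w *\<^sub>R F ((\<rho> / norm w) *\<^sub>R w))"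
        by (rule Bochner_Integration.integral_cong) (use True in \<open>auto simp: polar_density_def\<close>)
      also have "\<dots> = 0"
        using zero[OF True] unfolding integral_scaleR_right by (simp add: set_lebesgue_integral_def)
      finally show ?thesis .
    qed (simp add: polar_density_def)
  qed
  finally show ?thesis by simp
qed

text \<open>In polar coordinates the radial integrand is at most \<open>d / (1 + \<rho>)\<^sup>2\<close>.\<close>

lemma integrable_inverse_one_plus_norm_power:
  "integrable lborel (\<lambda>u::'a::euclidean_space. inverse ((1 + norm u) ^ Suc DIM('a)))"
proof (rule integrableI_bounded)
  let ?d = "DIM('a)"
  let ?g = "\<lambda>u::'a. ennreal (inverse ((1 + norm u) ^ Suc ?d))"
  let ?V = "emeasure lborel (ball (0::'a) 1)"
  have V: "?V < \<infinity>"
    using emeasure_bounded_finite[OF bounded_ball, of "0::'a" 1] by simp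
  have "(\<integral>\<^sup>+u. ennreal (norm (inverse ((1 + norm (u::'a)) ^ Suc ?d))) \<partial>lborel) = (\<integral>\<^sup>+u. ?g u \<partial>lborel)"
    by (simp add: add_nonneg_nonneg)
  also have "\<dots> = (\<integral>\<^sup>+\<rho>. \<integral>\<^sup>+w. ennreal (polar_density \<rho> w) * ?g ((\<rho> / norm w) *\<^sub>R w) \<partial>lborel \<partial>lborel)"
    by (rule nn_integral_polar[symmetric]) simp
  also have "\<dots> \<le> (\<integral>\<^sup>+\<rho>. \<integral>\<^sup>+w. ennreal (real ?d / (1 + \<rho>)\<^sup>2) * indicator {0..} \<rho> *
      indicator (ball (0::'a) 1) w \<partial>lborel \<partial>lborel)"
  proof (intro nn_integral_mono)
    fix \<rho> :: real and w :: 'a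
    show "ennreal (polar_density \<rho> w) * ?g ((\<rho> / norm w) *\<^sub>R w)
      \<le> ennreal (real ?d / (1 + \<rho>)\<^sup>2) * indicator {0..} \<rho> * indicator (ball 0 1) w"
    proof (cases "\<rho> > 0 \<and> w \<in> ball 0 1 - {0}")
      case True
      then have r: "\<rho> > 0" by simp
      obtain e where e: "?d = Suc e" by (cases ?d) auto
      have "\<rho> ^ e \<le> (1 + \<rho>) ^ e" using r by (intro power_mono) auto
      then have "\<rho> ^ e * (1 + \<rho>)\<^sup>2 \<le> (1 + \<rho>) ^ e * (1 + \<rho>)\<^sup>2"
        using r by (intro mult_right_mono) auto
      then have "\<rho> ^ e * (1 + \<rho>)\<^sup>2 \<le> (1 + \<rho>) ^ Suc (Suc e)"
        by (simp add: power2_eq_square mult_ac)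
      then have "\<rho> ^ e * inverse ((1 + \<rho>) ^ Suc (Suc e)) \<le> 1 / (1 + \<rho>)\<^sup>2"
        using r by (simp add: divide_simps)
      then have "real ?d * \<rho> ^ e * inverse ((1 + \<rho>) ^ Suc (Suc e)) \<le> real ?d / (1 + \<rho>)\<^sup>2"
        using mult_left_mono[of _ _ "real ?d"] by (fastforce simp: mult.assoc)
      then have "polar_density \<rho> w * inverse ((1 + norm ((\<rho> / norm w) *\<^sub>R w)) ^ Suc ?d)
          \<le> real ?d / (1 + \<rho>)\<^sup>2"
        using True r unfolding polar_density_def e by simp
      then show ?thesis
        using True by (simp flip: ennreal_mult add: ennreal_leI)
    next
      case False
      then have "polar_density \<rho> w = 0" by (auto simp: polar_density_def)
      then show ?thesis by simp
    qed
  qed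
  also have "\<dots> = (\<integral>\<^sup>+\<rho>. ennreal (real ?d / (1 + \<rho>)\<^sup>2) * indicator {0..} \<rho> * ?V \<partial>lborel)"
    by (intro nn_integral_cong nn_integral_cmult_indicator) simp
  also have "\<dots> = (\<integral>\<^sup>+\<rho>. ennreal (real ?d / (1 + \<rho>)\<^sup>2) * indicator {0..} \<rho> \<partial>lborel) * ?V"
    by (rule nn_integral_multc) measurable
  also have "(\<integral>\<^sup>+\<rho>. ennreal (real ?d / (1 + \<rho>)\<^sup>2) * indicator {0..} \<rho> \<partial>lborel)
      = ennreal (0 - (- (real ?d / (1 + 0))))"
  proof (rule nn_integral_FTC_atLeast[where F = "\<lambda>\<rho>. - (real ?d / (1 + \<rho>))"])
    fix \<rho> :: real assume "0 \<le> \<rho>"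
    then show "((\<lambda>\<rho>. - (real ?d / (1 + \<rho>))) has_real_derivative real ?d / (1 + \<rho>)\<^sup>2) (at \<rho>)"
      by (auto intro!: derivative_eq_intros simp: power2_eq_square)
  next
    have "filterlim (\<lambda>\<rho>::real. 1 + \<rho>) at_infinity at_top"
      using filterlim_at_top_imp_at_infinity filterlim_tendsto_add_at_top[OF tendsto_const filterlim_ident]
      by blast
    then have "((\<lambda>\<rho>. - (real ?d / (1 + \<rho>))) \<longlongrightarrow> - 0) at_top"
      by (intro tendsto_minus tendsto_divide_0[OF tendsto_const])
    then show "((\<lambda>\<rho>. - (real ?d / (1 + \<rho>))) \<longlongrightarrow> 0) at_top" by simp
  qed auto
  also have "ennreal (0 - (- (real ?d / (1 + 0)))) * ?V < \<infinity>"
    using V by (auto simp: ennreal_mult_less_top)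
  finally show "(\<integral>\<^sup>+u. ennreal (norm (inverse ((1 + norm (u::'a)) ^ Suc ?d))) \<partial>lborel) < \<infinity>" .
qed simp

section \<open>Dominated integrals and the twisted setting\<close>

text \<open>Differentiation under the integral sign: the mean value inequality bounds the difference
  quotients by \<open>g\<close>, their integrals are zero, and dominated convergence applies.\<close>

lemma integral_vector_derivative_eq_0:
  fixes K :: "real \<Rightarrow> 'a \<Rightarrow> 'b::{banach, second_countable_topology}"
  assumes \<delta>: "\<delta> > 0"
    and deriv: "\<And>\<tau> u. 0 \<le> \<tau> \<Longrightarrow> \<tau> \<le> \<delta> \<Longrightarrow> ((\<lambda>\<tau>. K \<tau> u) has_vector_derivative K' \<tau> u) (at \<tau>)"
    and bound: "\<And>\<tau> u. 0 \<le> \<tau> \<Longrightarrow> \<tau> \<le> \<delta> \<Longrightarrow> norm (K' \<tau> u) \<le> g u"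
    and g: "integrable M g"
    and int: "\<And>\<tau>. 0 \<le> \<tau> \<Longrightarrow> \<tau> \<le> \<delta> \<Longrightarrow> integrable M (K \<tau>)"
    and zero: "\<And>\<tau>. 0 \<le> \<tau> \<Longrightarrow> \<tau> \<le> \<delta> \<Longrightarrow> integral\<^sup>L M (K \<tau>) = 0"
  shows "integral\<^sup>L M (K' 0) = 0"
proof -
  define h where "h n = \<delta> / real (Suc n)" for n
  have h: "0 < h n" "h n \<le> \<delta>" for n
    using \<delta> by (auto simp: h_def field_simps)
  have h0: "h \<longlonglongrightarrow> 0"
    unfolding h_def by (rule LIMSEQ_Suc, rule lim_const_over_n)
  define S where "S n u = (1 / h n) *\<^sub>R (K (h n) u - K 0 u)" for n u
  have S_int: "integrable M (S n)" for n
    unfolding S_def[abs_def] using h[of n] \<delta> int by (intro integrable_scaleR_right Bochner_Integration.integrable_diff) auto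
  have lim: "(\<lambda>n. S n u) \<longlonglongrightarrow> K' 0 u" for u
  proof -
    have "((\<lambda>\<tau>. (1 / \<tau>) *\<^sub>R (K \<tau> u - K 0 u)) \<longlongrightarrow> K' 0 u) (at 0)"
    proof -
      have "((\<lambda>\<tau>. norm (K (0 + \<tau>) u - K 0 u - \<tau> *\<^sub>R K' 0 u) / norm \<tau>) \<longlongrightarrow> 0) (at 0)"
        using deriv[of 0 u] \<delta> unfolding has_vector_derivative_def has_derivative_at by simp
      moreover have "\<forall>\<^sub>F \<tau> in at 0. norm (K (0 + \<tau>) u - K 0 u - \<tau> *\<^sub>R K' 0 u) / norm \<tau>
          = norm ((1 / \<tau>) *\<^sub>R (K \<tau> u - K 0 u) - K' 0 u)"
      proof (rule eventually_at_topological[THEN iffD2], intro exI[of _ UNIV] conjI ballI impI)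
        fix \<tau> :: real assume "\<tau> \<noteq> 0"
        then have "(1 / \<tau>) *\<^sub>R (K \<tau> u - K 0 u) - K' 0 u = (1 / \<tau>) *\<^sub>R (K (0 + \<tau>) u - K 0 u - \<tau> *\<^sub>R K' 0 u)"
          by (simp add: scaleR_diff_right)
        then show "norm (K (0 + \<tau>) u - K 0 u - \<tau> *\<^sub>R K' 0 u) / norm \<tau>
          = norm ((1 / \<tau>) *\<^sub>R (K \<tau> u - K 0 u) - K' 0 u)"
          by simp
      qed auto
      ultimately have "((\<lambda>\<tau>. norm ((1 / \<tau>) *\<^sub>R (K \<tau> u - K 0 u) - K' 0 u)) \<longlongrightarrow> 0) (at 0)"
        by (rule Lim_transform_eventually)
      then show ?thesis by (simp add: tendsto_norm_zero_iff LIM_zero_iff)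
    qed
    moreover have "filterlim h (at 0) sequentially"
      using h0 h(1) by (auto simp: filterlim_at intro!: always_eventually dest: less_imp_neq[THEN not_sym])
    ultimately show ?thesis unfolding S_def by (rule filterlim_compose)
  qed
  have dom: "norm (S n u) \<le> g u" for n u
  proof -
    have "norm (K (h n) u - K 0 u) \<le> g u * norm (h n - 0)"
    proof (rule differentiable_bound[of "{0..\<delta>}"])
      fix \<tau> assume t: "\<tau> \<in> {0..\<delta>}"
      then show "((\<lambda>\<tau>. K \<tau> u) has_derivative (\<lambda>x. x *\<^sub>R K' \<tau> u)) (at \<tau> within {0..\<delta>})"
        using deriv[of \<tau> u] by (auto simp: has_vector_derivative_def intro: has_derivative_at_withinI)
      show "onorm (\<lambda>x. x *\<^sub>R K' \<tau> u) \<le> g u"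
        using bound[of \<tau> u] t by (auto intro!: onorm_bound mult_left_mono simp: mult.commute order_trans[OF norm_ge_zero])
    qed (use h[of n] \<delta> in auto)
    then show ?thesis using h[of n] unfolding S_def norm_scaleR by (simp add: divide_le_eq)
  qed
  have "(\<lambda>n. integral\<^sup>L M (S n)) \<longlonglongrightarrow> integral\<^sup>L M (K' 0)"
  proof (rule integral_dominated_convergence[where w = g])
    show "K' 0 \<in> borel_measurable M"
      using borel_measurable_integrable[OF S_int] lim by (rule borel_measurable_LIMSEQ_metric)
  qed (use S_int g lim dom in auto)
  moreover have "integral\<^sup>L M (S n) = 0" for n
    using h[of n] \<delta> int zero unfolding S_def
    by (subst integral_scaleR_right, subst Bochner_Integration.integral_diff) auto
  ultimately show ?thesis by (simp add: LIMSEQ_const_iff)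
qed

lemma gaussian_exponent_bound:
  fixes b c R :: real
  assumes "0 \<le> b" "b < c" "0 \<le> R"
  obtains B where "B > 0" "\<And>x. 0 \<le> x \<Longrightarrow> (1 + x) ^ K * exp (b * (x + R)\<^sup>2 - c * x\<^sup>2) \<le> B"
proof
  \<comment> \<open>Since \<open>(1 + x)\<^sup>K \<le> exp (K x)\<close>, the exponent is at most \<open>L x - (c - b) x\<^sup>2 + b R\<^sup>2\<close>; complete the square.\<close>
  define L where "L = real K + 2 * b * R"
  define B where "B = exp (L\<^sup>2 / (4 * (c - b)) + b * R\<^sup>2)"
  show "B > 0" by (simp add: B_def)
  fix x :: real assume x: "0 \<le> x"
  have "(1 + x) ^ K \<le> exp x ^ K"
    using x exp_ge_add_one_self[of x] by (intro power_mono) auto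
  also have "\<dots> = exp (real K * x)"
    by (simp add: exp_of_nat_mult)
  finally have "(1 + x) ^ K * exp (b * (x + R)\<^sup>2 - c * x\<^sup>2)
      \<le> exp (real K * x) * exp (b * (x + R)\<^sup>2 - c * x\<^sup>2)"
    by (rule mult_right_mono) simp
  also have "\<dots> = exp (L * x - (c - b) * x\<^sup>2 + b * R\<^sup>2)"
    by (simp add: L_def flip: exp_add) (simp add: algebra_simps power2_eq_square)
  also have "\<dots> \<le> B"
  proof -
    have "0 \<le> (2 * (c - b) * x - L)\<^sup>2 / (4 * (c - b))"
      using assms by simp
    also have "\<dots> = (c - b) * x\<^sup>2 - L * x + L\<^sup>2 / (4 * (c - b))"
      using assms by (simp add: field_simps power2_eq_square)
    finally show ?thesis by (simp add: B_def)
  qed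
  finally show "(1 + x) ^ K * exp (b * (x + R)\<^sup>2 - c * x\<^sup>2) \<le> B" .
qed

text \<open>The integrable majorant to which every dominated convergence argument is reduced.\<close>

definition weight :: "'a::euclidean_space \<Rightarrow> real"
  where "weight u = inverse ((1 + norm u) ^ Suc DIM('a))"

lemma weight_integrable: "integrable lborel weight"
  using integrable_inverse_one_plus_norm_power by (simp add: weight_def[abs_def])

lemma weight_nonneg [simp]: "0 \<le> weight u"
  by (simp add: weight_def)

lemma one_plus_norm_power_weight:
  "(1 + norm u) ^ (K + Suc DIM('a)) * weight u = (1 + norm u) ^ K" for u :: "'a::euclidean_space"
proof -
  have "1 + norm u \<noteq> 0" using norm_ge_zero[of u] by linarith
  then show ?thesis unfolding weight_def power_add mult.assoc by (subst right_inverse) auto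
qed

text \<open>The twisted convolution depends on \<open>U\<close> and \<open>\<lambda>\<close> only through an orthogonal complex structure \<open>J\<close>
  and one positive number \<open>a\<close>, which will be \<open>|\<lambda>| / 2\<close>.\<close>

locale twisted_space =
  fixes J :: "'a::euclidean_space \<Rightarrow> 'a" and a :: real
  assumes linear_J: "linear J"
    and J_skew: "J x \<bullet> y = - (x \<bullet> J y)"
    and J_J: "J (J x) = - x"
    and a_pos: "a > 0"
begin

definition rapid :: "('a \<Rightarrow> complex) \<Rightarrow> bool"
  where "rapid f \<longleftrightarrow> continuous_on UNIV f \<and>
    (\<forall>k. \<exists>C. \<forall>u. norm (f u) * (1 + norm u) ^ k * exp (a / 2 * (norm u)\<^sup>2) \<le> C)"

text \<open>Radial test profiles, to be evaluated at \<open>t = |u - z|\<^sup>2\<close>. They vanish inside the sphere \<open>t = s\<close>, and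
  their growth stays strictly below \<open>exp (a t / 2)\<close>: this gap makes the integral against a rapid
  function converge for every centre \<open>z\<close>, locally uniformly in \<open>z\<close>. At the critical rate
  convergence is guaranteed for \<open>z = 0\<close> only.\<close>

definition admissible :: "real \<Rightarrow> (real \<Rightarrow> real) \<Rightarrow> bool"
  where "admissible s \<phi> \<longleftrightarrow> continuous_on UNIV \<phi> \<and> (\<forall>t\<le>s. \<phi> t = 0) \<and>
    (\<exists>C N b. 0 \<le> b \<and> b < a / 2 \<and> (\<forall>t\<ge>0. \<bar>\<phi> t\<bar> \<le> C * (1 + t) ^ N * exp (b * t)))"

text \<open>With \<open>x = |u|\<close> the product is at most a power of \<open>1 + x\<close> times \<open>exp (b (x + R)\<^sup>2 - a x\<^sup>2 / 2)\<close>, and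
  \<open>b < a / 2\<close>.\<close>

lemma rapid_admissible_bound:
  assumes "rapid f" "admissible s \<phi>" "0 \<le> R"
  obtains B where "0 \<le> B"
    "\<And>u z. norm z \<le> R \<Longrightarrow> norm (f u) * (1 + norm u) ^ K * \<bar>\<phi> ((norm (u - z))\<^sup>2)\<bar> \<le> B * weight u"
proof -
  obtain D where D: "\<And>u. norm (f u) * exp (a / 2 * (norm u)\<^sup>2) \<le> D"
    using assms(1) unfolding rapid_def by (metis (no_types) mult.right_neutral power_0)
  obtain C N b where b: "0 \<le> b" "b < a / 2"
    and C: "\<And>t. t \<ge> 0 \<Longrightarrow> \<bar>\<phi> t\<bar> \<le> C * (1 + t) ^ N * exp (b * t)"
    using assms(2) unfolding admissible_def by auto
  have C0: "0 \<le> C" using C[of 0] by simp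
  have D0: "0 \<le> D" using D[of 0] by (smt (verit) norm_ge_zero exp_ge_zero mult_nonneg_nonneg)
  obtain B where B: "B > 0" "\<And>x. 0 \<le> x \<Longrightarrow>
      (1 + x) ^ (K + 2 * N + Suc DIM('a)) * exp (b * (x + R)\<^sup>2 - a / 2 * x\<^sup>2) \<le> B"
    using gaussian_exponent_bound[OF b assms(3)] by metis
  let ?B = "D * C * (1 + R) ^ (2 * N) * B"
  show thesis
  proof
    show "0 \<le> ?B" using C0 D0 B assms(3) by simp
    fix u z :: 'a assume z: "norm z \<le> R"
    define x where "x = norm u"
    define t where "t = (norm (u - z))\<^sup>2"
    have x: "0 \<le> x" by (simp add: x_def)
    have "norm (u - z) \<le> x + R"
      using norm_triangle_ineq4[of u z] z by (simp add: x_def)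
    then have t: "t \<le> (x + R)\<^sup>2" "0 \<le> t" by (auto simp: t_def power_mono)
    have "1 + t \<le> (1 + x + R)\<^sup>2"
      using t x assms(3) by (simp add: power2_eq_square algebra_simps)
    also have "\<dots> \<le> ((1 + R) * (1 + x))\<^sup>2"
      using x assms(3) by (intro power_mono) (auto simp: algebra_simps)
    finally have "(1 + t) ^ N \<le> (((1 + R) * (1 + x))\<^sup>2) ^ N"
      using t by (intro power_mono) auto
    then have tN: "(1 + t) ^ N \<le> (1 + R) ^ (2 * N) * (1 + x) ^ (2 * N)"
      by (simp add: power_mult_distrib flip: power_mult)
    have "\<bar>\<phi> t\<bar> \<le> C * (1 + t) ^ N * exp (b * t)" using C t by simp
    also have "\<dots> \<le> C * ((1 + R) ^ (2 * N) * (1 + x) ^ (2 * N)) * exp (b * (x + R)\<^sup>2)"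
      using tN C0 t b x assms(3) by (intro mult_mono) (auto intro: mult_left_mono)
    finally have \<phi>: "\<bar>\<phi> t\<bar> \<le> C * ((1 + R) ^ (2 * N) * (1 + x) ^ (2 * N)) * exp (b * (x + R)\<^sup>2)" .
    have fu: "norm (f u) \<le> D * exp (- (a / 2 * x\<^sup>2))"
      using D[of u] by (simp add: x_def exp_minus field_simps)
    have "norm (f u) * (1 + x) ^ K * \<bar>\<phi> t\<bar> \<le> (D * exp (- (a / 2 * x\<^sup>2))) * (1 + x) ^ K *
        (C * ((1 + R) ^ (2 * N) * (1 + x) ^ (2 * N)) * exp (b * (x + R)\<^sup>2))"
      using fu \<phi> x D0 C0 by (intro mult_mono) auto
    also have "\<dots> = (D * C * (1 + R) ^ (2 * N)) *
        ((1 + x) ^ (K + 2 * N) * exp (b * (x + R)\<^sup>2 - a / 2 * x\<^sup>2))"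
    proof -
      have "exp (b * (x + R)\<^sup>2 - a / 2 * x\<^sup>2) = exp (- (a / 2 * x\<^sup>2)) * exp (b * (x + R)\<^sup>2)"
        by (simp flip: exp_add)
      then show ?thesis by (simp only: power_add mult_ac)
    qed
    also have "\<dots> = (D * C * (1 + R) ^ (2 * N)) *
        ((1 + x) ^ (K + 2 * N + Suc DIM('a)) * exp (b * (x + R)\<^sup>2 - a / 2 * x\<^sup>2)) * weight u"
      unfolding x_def one_plus_norm_power_weight[of u "K + 2 * N", symmetric]
      by (simp only: mult_ac)
    also have "\<dots> \<le> (D * C * (1 + R) ^ (2 * N)) * B * weight u"
      using B(2)[OF x] C0 D0 assms(3) by (intro mult_right_mono mult_left_mono) auto
    finally show "norm (f u) * (1 + norm u) ^ K * \<bar>\<phi> ((norm (u - z))\<^sup>2)\<bar> \<le> ?B * weight u"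
      by (simp add: x_def t_def)
  qed
qed
end

section \<open>Derivatives with respect to the centre\<close>

context twisted_space begin

definition twist :: "'a \<Rightarrow> 'a \<Rightarrow> complex"
  where "twist z u = cis (a * (J z \<bullet> u))"

text \<open>All integrals are taken over \<open>u\<close>, the argument of \<open>f\<close>, so that the centre \<open>z\<close> enters only through the
  explicit kernel and \<open>f\<close> itself is never differentiated. In the application \<open>u = z - w\<close>, and the
  phase \<open>a \<langle>z, J w\<rangle>\<close> becomes \<open>a \<langle>J z, u\<rangle>\<close> because \<open>\<langle>z, J z\<rangle> = 0\<close>.\<close>

definition twisted_integral :: "('a \<Rightarrow> complex) \<Rightarrow> ('a \<Rightarrow> complex) \<Rightarrow> (real \<Rightarrow> real) \<Rightarrow> 'a \<Rightarrow> complex"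
  where "twisted_integral f p \<phi> z =
    (LINT u|lborel. f u * (twist z u * p (u - z)) * complex_of_real (\<phi> ((norm (u - z))\<^sup>2)))"

text \<open>For \<open>\<sigma> = 1\<close> and \<open>\<sigma> = -1\<close> these are the complex-valued real-linear forms with
  \<open>form \<sigma> v (J w) = \<i> \<sigma> form \<sigma> v w\<close>, that is, the holomorphic and the antiholomorphic linear forms
  of the complex structure \<open>J\<close>.\<close>

definition form :: "real \<Rightarrow> 'a \<Rightarrow> 'a \<Rightarrow> complex"
  where "form \<sigma> v w = Complex (v \<bullet> w) (\<sigma> * (J v \<bullet> w))"

lemma form_eq: "form \<sigma> v w = of_real (v \<bullet> w) + \<i> * of_real (\<sigma> * (J v \<bullet> w))"
  by (simp add: form_def complex_eq_iff)

lemma form_diff: "form \<sigma> v (u - z) = form \<sigma> v u - form \<sigma> v z"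
  by (simp add: form_def complex_eq_iff inner_diff_right algebra_simps)

lemma norm_J [simp]: "norm (J x) = norm x"
proof -
  have "J x \<bullet> J x = x \<bullet> x" by (simp add: J_skew J_J)
  then show ?thesis by (simp add: norm_eq_sqrt_inner)
qed

lemma J_add: "J (x + y) = J x + J y" and J_scale: "J (c *\<^sub>R x) = c *\<^sub>R J x"
  using linear_J by (auto simp: linear_add linear_scale)

lemma norm_form: "\<bar>\<sigma>\<bar> = 1 \<Longrightarrow> norm (form \<sigma> v w) \<le> 2 * norm v * norm w"
proof -
  assume s: "\<bar>\<sigma>\<bar> = 1"
  have "norm (form \<sigma> v w) \<le> \<bar>v \<bullet> w\<bar> + \<bar>\<sigma> * (J v \<bullet> w)\<bar>"
    using cmod_le[of "form \<sigma> v w"] by (simp add: form_def)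
  also have "\<dots> \<le> norm v * norm w + norm v * norm w"
    using Cauchy_Schwarz_ineq2[of v w] Cauchy_Schwarz_ineq2[of "J v" w] s by (simp add: abs_mult)
  finally show ?thesis by simp
qed

lemma norm_twist [simp]: "norm (twist z u) = 1"
  by (simp add: twist_def)

lemma continuous_twist [continuous_intros]: "continuous_on S (twist z)"
  unfolding twist_def[abs_def] by (intro continuous_intros)

lemma continuous_form [continuous_intros]:
  "continuous_on S f \<Longrightarrow> continuous_on S (\<lambda>x. form \<sigma> v (f x))"
  unfolding form_eq by (intro continuous_intros)

lemma one_plus_norm_diff_le:
  assumes "norm z \<le> R"
  shows "1 + norm (u - z) \<le> (1 + R) * (1 + norm (u::'a))"
proof -
  have "0 \<le> R" using assms norm_ge_zero order_trans by blast
  then have "0 \<le> R * norm u" by simp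
  then show ?thesis
    using norm_triangle_ineq4[of u z] assms by (simp add: algebra_simps)
qed

lemma rapid_integrable:
  assumes f: "rapid f" and \<phi>: "admissible s \<phi>" and q: "continuous_on UNIV q"
    and bound: "\<And>u. norm (q u) \<le> C * (1 + norm u) ^ K"
  shows "integrable lborel (\<lambda>u. f u * q u * complex_of_real (\<phi> ((norm (u - z))\<^sup>2)))"
proof -
  obtain B where B: "\<And>u. norm (f u) * (1 + norm u) ^ K * \<bar>\<phi> ((norm (u - z))\<^sup>2)\<bar> \<le> B * weight u"
    using rapid_admissible_bound[OF f \<phi>, of "norm z" K] by (metis norm_ge_zero order_refl)
  have C: "0 \<le> C" using order_trans[OF norm_ge_zero bound[of 0]] by simp
  show ?thesis
  proof (rule Bochner_Integration.integrable_bound)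
    show "integrable lborel (\<lambda>u. (C * B) * weight u)"
      by (intro integrable_mult_right weight_integrable)
    have cf: "continuous_on UNIV f" and c\<phi>: "continuous_on UNIV \<phi>"
      using f \<phi> by (auto simp: rapid_def admissible_def)
    have "continuous_on UNIV (\<lambda>u. (norm (u - z))\<^sup>2)"
      by (intro continuous_intros)
    then have "continuous_on UNIV (\<lambda>u. \<phi> ((norm (u - z))\<^sup>2))"
      by (rule continuous_on_compose2[OF c\<phi>]) auto
    then have "continuous_on UNIV (\<lambda>u. f u * q u * complex_of_real (\<phi> ((norm (u - z))\<^sup>2)))"
      by (intro continuous_on_mult cf q continuous_on_of_real)
    then show "(\<lambda>u. f u * q u * complex_of_real (\<phi> ((norm (u - z))\<^sup>2))) \<in> borel_measurable lborel"
      using borel_measurable_continuous_onI by simp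
    show "AE u in lborel. norm (f u * q u * complex_of_real (\<phi> ((norm (u - z))\<^sup>2))) \<le> norm ((C * B) * weight u)"
    proof (rule AE_I2)
      fix u
      have "norm (f u * q u * complex_of_real (\<phi> ((norm (u - z))\<^sup>2))) =
          norm (f u) * norm (q u) * \<bar>\<phi> ((norm (u - z))\<^sup>2)\<bar>"
        by (simp add: norm_mult)
      also have "\<dots> \<le> norm (f u) * (C * (1 + norm u) ^ K) * \<bar>\<phi> ((norm (u - z))\<^sup>2)\<bar>"
        by (intro mult_right_mono mult_left_mono bound) auto
      also have "\<dots> = C * (norm (f u) * (1 + norm u) ^ K * \<bar>\<phi> ((norm (u - z))\<^sup>2)\<bar>)"
        by simp
      also have "\<dots> \<le> C * (B * weight u)"
        by (intro mult_left_mono B C)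
      also have "\<dots> \<le> norm ((C * B) * weight u)"
        by simp
      finally show "norm (f u * q u * complex_of_real (\<phi> ((norm (u - z))\<^sup>2))) \<le> norm ((C * B) * weight u)" .
    qed
  qed
qed

text \<open>The derivative of \<open>twisted_integral f p \<phi>\<close> at \<open>z\<close> in direction \<open>v\<close>: the three terms come from the
  phase, from \<open>p (u - z)\<close> and from \<open>\<phi> (|u - z|\<^sup>2)\<close>.\<close>

lemma twisted_integral_directional_derivative:
  assumes f: "rapid f" and \<phi>: "admissible s \<phi>" and \<phi>': "admissible s \<phi>'"
    and d\<phi>: "\<And>t. (\<phi> has_real_derivative \<phi>' t) (at t)"
    and dp: "\<And>w. (p has_derivative D w) (at w)"
    and pb: "\<And>w. norm (p w) \<le> C * (1 + norm w) ^ M"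
    and Db: "\<And>w v. norm (D w v) \<le> C * (1 + norm w) ^ M * norm v"
    and zero: "\<And>z. norm z < R \<Longrightarrow> twisted_integral f p \<phi> z = 0"
    and z: "norm z < R"
  shows "(LINT u|lborel. f u * twist z u *
      ((\<i> * of_real (a * (J v \<bullet> u)) * p (u - z) - D (u - z) v) * of_real (\<phi> ((norm (u - z))\<^sup>2))
       - of_real (2 * (v \<bullet> (u - z))) * p (u - z) * of_real (\<phi>' ((norm (u - z))\<^sup>2)))) = 0"
proof -
  have R: "0 \<le> R" using z norm_ge_zero[of z] by linarith
  have C: "0 \<le> C" using order_trans[OF norm_ge_zero pb[of 0]] by simp
  have cont_p: "continuous_on UNIV p"
    using has_derivative_continuous[OF dp] by (simp add: continuous_at_imp_continuous_on)
  define \<delta> where "\<delta> = (R - norm z) / (1 + norm v)"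
  have v1: "0 < 1 + norm v" using norm_ge_zero[of v] by linarith
  have \<delta>: "\<delta> > 0" using z v1 by (simp add: \<delta>_def)
  have small: "norm (z + \<tau> *\<^sub>R v) < R" if "0 \<le> \<tau>" "\<tau> \<le> \<delta>" for \<tau>
  proof -
    have "\<delta> * (1 + norm v) = R - norm z" using v1 by (simp add: \<delta>_def)
    then have "\<delta> * norm v < R - norm z" using \<delta> by (simp add: algebra_simps)
    moreover have "\<tau> * norm v \<le> \<delta> * norm v" using that by (intro mult_right_mono) auto
    ultimately show ?thesis using norm_triangle_ineq[of z "\<tau> *\<^sub>R v"] that by simp
  qed
  define K where "K \<tau> u = f u * (twist (z + \<tau> *\<^sub>R v) u * p (u - (z + \<tau> *\<^sub>R v))) *
      complex_of_real (\<phi> ((norm (u - (z + \<tau> *\<^sub>R v)))\<^sup>2))" for \<tau> u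
  define K' where "K' \<tau> u = f u * twist (z + \<tau> *\<^sub>R v) u *
      ((\<i> * of_real (a * (J v \<bullet> u)) * p (u - (z + \<tau> *\<^sub>R v)) - D (u - (z + \<tau> *\<^sub>R v)) v) *
         of_real (\<phi> ((norm (u - (z + \<tau> *\<^sub>R v)))\<^sup>2))
       - of_real (2 * (v \<bullet> (u - (z + \<tau> *\<^sub>R v)))) * p (u - (z + \<tau> *\<^sub>R v)) *
         of_real (\<phi>' ((norm (u - (z + \<tau> *\<^sub>R v)))\<^sup>2)))" for \<tau> u
  obtain B1 where B1: "\<And>u z. norm z \<le> R \<Longrightarrow>
      norm (f u) * (1 + norm u) ^ Suc M * \<bar>\<phi> ((norm (u - z))\<^sup>2)\<bar> \<le> B1 * weight u"
    using rapid_admissible_bound[OF f \<phi> R] by metis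
  obtain B2 where B2: "\<And>u z. norm z \<le> R \<Longrightarrow>
      norm (f u) * (1 + norm u) ^ Suc M * \<bar>\<phi>' ((norm (u - z))\<^sup>2)\<bar> \<le> B2 * weight u"
    using rapid_admissible_bound[OF f \<phi>' R] by metis
  define c1 where "c1 = (a * norm v + norm v) * (C * (1 + R) ^ M)"
  define c2 where "c2 = 2 * norm v * (1 + R) * (C * (1 + R) ^ M)"
  have c: "0 \<le> c1" "0 \<le> c2" using C R a_pos by (auto simp: c1_def c2_def)
  have "integral\<^sup>L lborel (K' 0) = 0"
  proof (rule integral_vector_derivative_eq_0[OF \<delta>])
    show "integrable lborel (\<lambda>u. c1 * (B1 * weight u) + c2 * (B2 * weight u))"
      by (intro Bochner_Integration.integrable_add integrable_mult_right weight_integrable)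
    fix \<tau> assume "0 \<le> \<tau>" "\<tau> \<le> \<delta>"
    then have zt: "norm (z + \<tau> *\<^sub>R v) < R" by (rule small)
    show "integral\<^sup>L lborel (K \<tau>) = 0"
      using zero[OF zt] by (simp add: twisted_integral_def K_def[abs_def])
    have "continuous_on UNIV (\<lambda>u. twist (z + \<tau> *\<^sub>R v) u * p (u - (z + \<tau> *\<^sub>R v)))"
      by (intro continuous_on_mult continuous_twist continuous_on_compose2[OF cont_p, of _ "\<lambda>u. u - _"])
         (auto intro!: continuous_on_diff continuous_on_id continuous_on_const)
    moreover have pw: "C * (1 + norm (u - (z + \<tau> *\<^sub>R v))) ^ M \<le> C * (1 + R) ^ M * (1 + norm u) ^ M" for u
    proof -
      have "(1 + norm (u - (z + \<tau> *\<^sub>R v))) ^ M \<le> ((1 + R) * (1 + norm u)) ^ M"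
        using zt by (intro power_mono one_plus_norm_diff_le) auto
      then show ?thesis using C by (simp add: power_mult_distrib mult.assoc mult_left_mono)
    qed
    ultimately show "integrable lborel (K \<tau>)"
      unfolding K_def[abs_def]
      by (intro rapid_integrable[OF f \<phi>, where C = "C * (1 + R) ^ M" and K = M])
         (auto simp: norm_mult intro: order_trans[OF pb])
    fix u
    define w where "w = u - (z + \<tau> *\<^sub>R v)"
    show "((\<lambda>\<tau>. K \<tau> u) has_vector_derivative K' \<tau> u) (at \<tau>)"
    proof -
      have 1: "((\<lambda>\<tau>. twist (z + \<tau> *\<^sub>R v) u) has_vector_derivative
          \<i> * of_real (a * (J v \<bullet> u)) * twist (z + \<tau> *\<^sub>R v) u) (at \<tau>)"
        unfolding twist_def has_vector_derivative_def J_add J_scale inner_add_left inner_scaleR_left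
        by (auto intro!: derivative_eq_intros simp: scaleR_conv_of_real algebra_simps)
      have line: "((\<lambda>\<tau>. u - (z + \<tau> *\<^sub>R v)) has_vector_derivative - v) (at \<tau>)"
        by (auto intro!: derivative_eq_intros)
      have lin: "D w (- v) = - D w v"
        using has_derivative_bounded_linear[OF dp] bounded_linear.linear linear_neg by blast
      have 2: "((\<lambda>\<tau>. p (u - (z + \<tau> *\<^sub>R v))) has_vector_derivative - D w v) (at \<tau>)"
        using vector_derivative_diff_chain_within[OF line has_derivative_at_withinI[OF dp]] lin
        by (simp add: o_def w_def)
      have 3: "((\<lambda>\<tau>. (norm (u - (z + \<tau> *\<^sub>R v)))\<^sup>2) has_real_derivative - 2 * (v \<bullet> w)) (at \<tau>)"
        unfolding power2_norm_eq_inner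
        using line unfolding has_vector_derivative_def has_field_derivative_def
        by (auto intro!: derivative_eq_intros simp: w_def inner_commute algebra_simps fun_eq_iff)
      have 4: "((\<lambda>\<tau>. complex_of_real (\<phi> ((norm (u - (z + \<tau> *\<^sub>R v)))\<^sup>2))) has_vector_derivative
          of_real (\<phi>' ((norm w)\<^sup>2) * (- 2 * (v \<bullet> w)))) (at \<tau>)"
        by (intro has_vector_derivative_of_real)
           (use DERIV_chain2[OF d\<phi> 3] in \<open>simp add: w_def has_real_derivative_iff_has_vector_derivative\<close>)
      show ?thesis
        unfolding K_def K'_def
        by (rule has_vector_derivative_eq_rhs,
            rule has_vector_derivative_mult[OF has_vector_derivative_mult_right[OF
              has_vector_derivative_mult[OF 1 2]] 4])
           (simp add: w_def[symmetric] algebra_simps)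
    qed
    show "norm (K' \<tau> u) \<le> c1 * (B1 * weight u) + c2 * (B2 * weight u)"
    proof -
      define P where "P = C * (1 + R) ^ M * (1 + norm u) ^ M"
      have P: "norm (p w) \<le> P" "norm (D w v) \<le> P * norm v" "0 \<le> P"
        using order_trans[OF pb pw] order_trans[OF Db mult_right_mono[OF pw norm_ge_zero]] C R
        by (auto simp: P_def w_def)
      have w: "norm w \<le> (1 + R) * (1 + norm u)"
        using one_plus_norm_diff_le[of "z + \<tau> *\<^sub>R v" R u] zt by (simp add: w_def)
      have vw: "\<bar>v \<bullet> w\<bar> \<le> norm v * ((1 + R) * (1 + norm u))"
        by (rule order_trans[OF Cauchy_Schwarz_ineq2]) (intro mult_left_mono w norm_ge_zero)
      have vu: "\<bar>J v \<bullet> u\<bar> \<le> norm v * (1 + norm u)"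
        using Cauchy_Schwarz_ineq2[of "J v" u] by (simp add: algebra_simps add_increasing)
      have A: "norm (\<i> * of_real (a * (J v \<bullet> u)) * p w - D w v) \<le> c1 * (1 + norm u) ^ Suc M"
      proof -
        have "norm (\<i> * of_real (a * (J v \<bullet> u)) * p w - D w v)
            \<le> a * \<bar>J v \<bullet> u\<bar> * norm (p w) + norm (D w v)"
          by (rule order_trans[OF norm_triangle_ineq4]) (use a_pos in \<open>simp add: norm_mult abs_mult\<close>)
        also have "\<dots> \<le> a * (norm v * (1 + norm u)) * P + P * norm v * (1 + norm u)"
        proof (intro add_mono mult_mono vu P)
          have "P * norm v * 1 \<le> P * norm v * (1 + norm u)"
            using P by (intro mult_left_mono) auto
          then show "norm (D w v) \<le> P * norm v * (1 + norm u)" using P(2) by simp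
        qed (use a_pos in auto)
        also have "\<dots> = c1 * (1 + norm u) ^ Suc M"
          by (simp add: c1_def P_def algebra_simps)
        finally show ?thesis .
      qed
      have A2: "norm (complex_of_real (2 * (v \<bullet> w)) * p w) \<le> c2 * (1 + norm u) ^ Suc M"
      proof -
        have "norm (complex_of_real (2 * (v \<bullet> w)) * p w) = 2 * \<bar>v \<bullet> w\<bar> * norm (p w)"
          by (simp add: norm_mult)
        also have "\<dots> \<le> 2 * (norm v * ((1 + R) * (1 + norm u))) * P"
          using R by (intro mult_mono mult_left_mono vw P) auto
        also have "\<dots> = c2 * (1 + norm u) ^ Suc M"
          by (simp add: c2_def P_def algebra_simps)
        finally show ?thesis .
      qed
      define X where "X = \<i> * of_real (a * (J v \<bullet> u)) * p w - D w v"
      define Y where "Y = complex_of_real (2 * (v \<bullet> w)) * p w"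
      have "norm (K' \<tau> u) = norm (f u) *
          norm (X * of_real (\<phi> ((norm w)\<^sup>2)) - Y * of_real (\<phi>' ((norm w)\<^sup>2)))"
        by (simp only: K'_def X_def Y_def w_def norm_mult norm_twist mult_1_right)
      also have "\<dots> \<le> norm (f u) * (norm X * \<bar>\<phi> ((norm w)\<^sup>2)\<bar> + norm Y * \<bar>\<phi>' ((norm w)\<^sup>2)\<bar>)"
        by (intro mult_left_mono order_trans[OF norm_triangle_ineq4]) (simp_all add: norm_mult)
      also have "\<dots> \<le> norm (f u) * (c1 * (1 + norm u) ^ Suc M * \<bar>\<phi> ((norm w)\<^sup>2)\<bar> +
          c2 * (1 + norm u) ^ Suc M * \<bar>\<phi>' ((norm w)\<^sup>2)\<bar>)"
        using A A2 unfolding X_def Y_def by (intro mult_left_mono add_mono mult_right_mono) auto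
      also have "\<dots> = c1 * (norm (f u) * (1 + norm u) ^ Suc M * \<bar>\<phi> ((norm w)\<^sup>2)\<bar>) +
          c2 * (norm (f u) * (1 + norm u) ^ Suc M * \<bar>\<phi>' ((norm w)\<^sup>2)\<bar>)"
        by (simp only: distrib_left mult_ac)
      also have "\<dots> \<le> c1 * (B1 * weight u) + c2 * (B2 * weight u)"
        unfolding w_def using zt by (intro add_mono mult_left_mono B1 B2 c) auto
      finally show ?thesis .
    qed
  qed
  then show ?thesis by (simp add: K'_def[abs_def])
qed

text \<open>Functions of polynomial growth that satisfy the Cauchy-Riemann equations for \<open>J\<close> (if \<open>\<sigma> = 1\<close>) or
  the conjugate ones (if \<open>\<sigma> = -1\<close>), so that the operator \<open>\<partial>\<^sub>v + \<i> \<sigma> \<partial>\<close> in direction \<open>J v\<close> annihilates them.\<close>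

definition cr_poly :: "real \<Rightarrow> ('a \<Rightarrow> complex) \<Rightarrow> bool"
  where "cr_poly \<sigma> p \<longleftrightarrow> (\<exists>D C M.
    (\<forall>w. (p has_derivative D w) (at w)) \<and> (\<forall>v. continuous_on UNIV (\<lambda>w. D w v)) \<and>
    (\<forall>w v. D w (J v) = \<i> * of_real \<sigma> * D w v) \<and>
    (\<forall>w. norm (p w) \<le> C * (1 + norm w) ^ M) \<and>
    (\<forall>w v. norm (D w v) \<le> C * (1 + norm w) ^ M * norm v))"

lemma cr_poly_1: "cr_poly \<sigma> (\<lambda>_. 1)"
  unfolding cr_poly_def
  by (rule exI[of _ "\<lambda>_ _. 0"], rule exI[of _ 1], rule exI[of _ 0]) simp

lemma form_J: "\<bar>\<sigma>\<bar> = 1 \<Longrightarrow> form \<sigma> v (J w) = \<i> * of_real \<sigma> * form \<sigma> v w"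
  using abs_mult_self_eq[of \<sigma>] J_skew[of v w]
  by (simp add: form_def complex_eq_iff J_skew J_J flip: mult.assoc)

lemma bounded_linear_form: "bounded_linear (form \<sigma> v)"
  unfolding form_eq[abs_def]
  by (intro bounded_linear_add bounded_linear_const_mult bounded_linear_compose[OF bounded_linear_of_real]
      bounded_linear_inner_right)

lemma cr_poly_mult_form:
  assumes s: "\<bar>\<sigma>\<bar> = 1" and p: "cr_poly \<sigma> p"
  shows "cr_poly \<sigma> (\<lambda>w. form \<sigma> v w * p w)"
proof -
  obtain D C M where D: "\<And>w. (p has_derivative D w) (at w)" "\<And>v. continuous_on UNIV (\<lambda>w. D w v)"
    "\<And>w v. D w (J v) = \<i> * of_real \<sigma> * D w v"
    and b: "\<And>w. norm (p w) \<le> C * (1 + norm w) ^ M"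
    "\<And>w v. norm (D w v) \<le> C * (1 + norm w) ^ M * norm v"
    using p unfolding cr_poly_def by metis
  have C: "0 \<le> C" using order_trans[OF norm_ge_zero b(1)[of 0]] by simp
  have p_cont: "continuous_on UNIV p"
    using has_derivative_continuous[OF D(1)] by (simp add: continuous_at_imp_continuous_on)
  have fw: "norm (form \<sigma> v w) \<le> 2 * norm v * (1 + norm w)" for w
    using norm_form[OF s, of v w] by (simp add: algebra_simps add_increasing)
  define E where "E w x = form \<sigma> v w * D w x + form \<sigma> v x * p w" for w x
  let ?C = "4 * norm v * C"
  have nn: "0 \<le> C * (1 + norm w) ^ M" for w using C by simp
  show ?thesis
    unfolding cr_poly_def
  proof (intro exI conjI allI)
    fix w x :: 'a
    show "((\<lambda>w. form \<sigma> v w * p w) has_derivative E w) (at w)"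
      unfolding E_def
      by (rule has_derivative_mult[OF bounded_linear_imp_has_derivative[OF bounded_linear_form] D(1)])
    show "continuous_on UNIV (\<lambda>w. E w x)"
      unfolding E_def
      by (intro continuous_on_add continuous_on_mult continuous_form continuous_on_id continuous_on_const D(2) p_cont)
    show "E w (J x) = \<i> * of_real \<sigma> * E w x"
      by (simp add: E_def D(3) form_J[OF s] algebra_simps)
    have "norm (form \<sigma> v w * p w) \<le> (2 * norm v * (1 + norm w)) * (C * (1 + norm w) ^ M)"
      unfolding norm_mult by (intro mult_mono fw b) auto
    also have "\<dots> \<le> ?C * (1 + norm w) ^ Suc M"
      using mult_nonneg_nonneg[OF nn[of w], of "norm v * (1 + norm w)"] by (simp add: algebra_simps)
    finally show "norm (form \<sigma> v w * p w) \<le> ?C * (1 + norm w) ^ Suc M" .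
    have "norm (E w x) \<le> norm (form \<sigma> v w) * norm (D w x) + norm (form \<sigma> v x) * norm (p w)"
      unfolding E_def by (rule order_trans[OF norm_triangle_ineq]) (simp add: norm_mult)
    also have "\<dots> \<le> (2 * norm v * (1 + norm w)) * (C * (1 + norm w) ^ M * norm x)
        + (2 * norm v * norm x) * (C * (1 + norm w) ^ M)"
      by (intro add_mono mult_mono fw b norm_form s) auto
    also have "\<dots> \<le> ?C * (1 + norm w) ^ Suc M * norm x"
    proof -
      have "0 \<le> C * (1 + norm w) ^ M * (norm v * norm x * norm w)"
        by (intro mult_nonneg_nonneg nn) auto
      then show ?thesis by (simp add: algebra_simps)
    qed
    finally show "norm (E w x) \<le> ?C * (1 + norm w) ^ Suc M * norm x" .
  qed
qed

lemma poly_bound_shift: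
  assumes "\<And>w. norm (q w) \<le> C * (1 + norm w) ^ M"
  shows "norm (q (u - z)) \<le> C * (1 + norm z) ^ M * (1 + norm (u::'a)) ^ M"
proof -
  have C: "0 \<le> C" using order_trans[OF norm_ge_zero assms[of 0]] by simp
  have "(1 + norm (u - z)) ^ M \<le> ((1 + norm z) * (1 + norm u)) ^ M"
    by (intro power_mono one_plus_norm_diff_le) auto
  then have "C * (1 + norm (u - z)) ^ M \<le> C * (1 + norm z) ^ M * (1 + norm u) ^ M"
    using C by (simp add: power_mult_distrib mult.assoc mult_left_mono)
  then show ?thesis using assms order_trans by blast
qed

text \<open>The commutation rule behind the whole proof. Add \<open>\<i> \<sigma>\<close> times the derivative in direction \<open>J v\<close> to the
  derivative in direction \<open>v\<close>. The derivatives of \<open>p\<close> cancel. The phase contributes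
  \<open>\<sigma> a form \<sigma> v u\<close> and the profile contributes \<open>-2 form \<sigma> v (u - z)\<close> times \<open>\<phi>'\<close>; writing
  \<open>form \<sigma> v u = form \<sigma> v (u - z) + form \<sigma> v z\<close> leaves, besides a multiple of the integral that
  vanishes already, the integral with the extra factor \<open>form \<sigma> v (u - z)\<close> and with
  \<open>\<sigma> a \<phi> - 2 \<phi>'\<close> in place of \<open>\<phi>\<close>.\<close>

lemma twisted_integral_mult_form:
  assumes f: "rapid f" and \<phi>: "admissible s \<phi>" and \<phi>': "admissible s \<phi>'"
    and d\<phi>: "\<And>t. (\<phi> has_real_derivative \<phi>' t) (at t)"
    and \<sigma>: "\<bar>\<sigma>\<bar> = 1" and p: "cr_poly \<sigma> p"
    and zero: "\<And>z. norm z < R \<Longrightarrow> twisted_integral f p \<phi> z = 0"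
    and z: "norm z < R"
  shows "twisted_integral f (\<lambda>w. form \<sigma> v w * p w) (\<lambda>t. \<sigma> * a * \<phi> t - 2 * \<phi>' t) z = 0"
proof -
  obtain D C M where D: "\<And>w. (p has_derivative D w) (at w)" "\<And>v. continuous_on UNIV (\<lambda>w. D w v)"
    "\<And>w v. D w (J v) = \<i> * of_real \<sigma> * D w v"
    and b: "\<And>w. norm (p w) \<le> C * (1 + norm w) ^ M"
    "\<And>w v. norm (D w v) \<le> C * (1 + norm w) ^ M * norm v"
    using p unfolding cr_poly_def by metis
  have C: "0 \<le> C" using order_trans[OF norm_ge_zero b(1)[of 0]] by simp
  have p_cont: "continuous_on UNIV p"
    using has_derivative_continuous[OF D(1)] by (simp add: continuous_at_imp_continuous_on)
  have shift: "continuous_on UNIV (\<lambda>u. q (u - z))" if "continuous_on UNIV q" for q :: "'a \<Rightarrow> complex"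
    by (rule continuous_on_compose2[OF that]) (auto intro!: continuous_on_diff continuous_on_id continuous_on_const)
  let ?\<phi> = "\<lambda>u. complex_of_real (\<phi> ((norm (u - z))\<^sup>2))"
  let ?\<phi>' = "\<lambda>u. complex_of_real (\<phi>' ((norm (u - z))\<^sup>2))"
  define Y where "Y u = f u * (twist z u * p (u - z)) * ?\<phi> u" for u
  have Y_int: "integrable lborel Y"
    unfolding Y_def[abs_def]
  proof (rule rapid_integrable[OF f \<phi>])
    show "continuous_on UNIV (\<lambda>u. twist z u * p (u - z))"
      by (intro continuous_on_mult continuous_twist shift[OF p_cont])
    show "norm (twist z u * p (u - z)) \<le> C * (1 + norm z) ^ M * (1 + norm u) ^ M" for u
      using poly_bound_shift[OF b(1)] by (simp add: norm_mult)
  qed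
  define X where "X v u = f u * twist z u *
      ((\<i> * of_real (a * (J v \<bullet> u)) * p (u - z) - D (u - z) v) * ?\<phi> u
       - of_real (2 * (v \<bullet> (u - z))) * p (u - z) * ?\<phi>' u)" for v u
  have X_zero: "integral\<^sup>L lborel (X v) = 0" for v
    unfolding X_def[abs_def]
    by (rule twisted_integral_directional_derivative[OF f \<phi> \<phi>' d\<phi> D(1) b zero z])
  have X_int: "integrable lborel (X v)" for v
  proof -
    let ?A = "\<lambda>u. f u * (\<i> * of_real (a * (J v \<bullet> u)) * (twist z u * p (u - z))) * ?\<phi> u"
    let ?B = "\<lambda>u. f u * (twist z u * D (u - z) v) * ?\<phi> u"
    let ?E = "\<lambda>u. f u * (of_real (2 * (v \<bullet> (u - z))) * (twist z u * p (u - z))) * ?\<phi>' u"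
    have pb: "norm (p (u - z)) \<le> C * (1 + norm z) ^ M * (1 + norm u) ^ M" for u
      by (rule poly_bound_shift[OF b(1)])
    have "integrable lborel ?A"
    proof (rule rapid_integrable[OF f \<phi>])
      show "continuous_on UNIV (\<lambda>u. \<i> * of_real (a * (J v \<bullet> u)) * (twist z u * p (u - z)))"
        by (intro continuous_on_mult continuous_twist shift[OF p_cont] continuous_on_const
            continuous_on_of_real continuous_on_inner continuous_on_id)
      fix u
      have "norm (\<i> * of_real (a * (J v \<bullet> u)) * (twist z u * p (u - z))) = a * \<bar>J v \<bullet> u\<bar> * norm (p (u - z))"
        using a_pos by (simp add: norm_mult abs_mult)
      also have "\<dots> \<le> a * (norm v * (1 + norm u)) * (C * (1 + norm z) ^ M * (1 + norm u) ^ M)"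
        using a_pos Cauchy_Schwarz_ineq2[of "J v" u]
        by (intro mult_mono pb) (auto simp: algebra_simps add_increasing)
      finally show "norm (\<i> * of_real (a * (J v \<bullet> u)) * (twist z u * p (u - z)))
        \<le> (a * norm v * C * (1 + norm z) ^ M) * (1 + norm u) ^ Suc M"
        by (simp only: power_Suc mult_ac)
    qed
    moreover have "integrable lborel ?B"
    proof (rule rapid_integrable[OF f \<phi>])
      show "continuous_on UNIV (\<lambda>u. twist z u * D (u - z) v)"
        by (intro continuous_on_mult continuous_twist shift[OF D(2)])
      fix u
      show "norm (twist z u * D (u - z) v) \<le> (C * norm v * (1 + norm z) ^ M) * (1 + norm u) ^ M"
        using poly_bound_shift[of "\<lambda>w. D w v" "C * norm v" M u z] b(2)[of _ v]
        by (simp add: norm_mult mult_ac)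
    qed
    moreover have "integrable lborel ?E"
    proof (rule rapid_integrable[OF f \<phi>'])
      show "continuous_on UNIV (\<lambda>u. of_real (2 * (v \<bullet> (u - z))) * (twist z u * p (u - z)))"
        by (intro continuous_on_mult continuous_twist shift[OF p_cont] continuous_on_const
            continuous_on_of_real continuous_on_inner continuous_on_diff continuous_on_id)
      fix u
      have "norm (of_real (2 * (v \<bullet> (u - z))) * (twist z u * p (u - z))) = 2 * \<bar>v \<bullet> (u - z)\<bar> * norm (p (u - z))"
        by (simp add: norm_mult)
      also have "\<dots> \<le> 2 * (norm v * ((1 + norm z) * (1 + norm u))) * (C * (1 + norm z) ^ M * (1 + norm u) ^ M)"
      proof (intro mult_mono pb mult_left_mono)
        have "norm (u - z) \<le> (1 + norm z) * (1 + norm u)"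
          using one_plus_norm_diff_le[of z "norm z" u] by simp
        then show "\<bar>v \<bullet> (u - z)\<bar> \<le> norm v * ((1 + norm z) * (1 + norm u))"
          by (intro order_trans[OF Cauchy_Schwarz_ineq2] mult_left_mono) auto
      qed auto
      finally show "norm (of_real (2 * (v \<bullet> (u - z))) * (twist z u * p (u - z)))
        \<le> (2 * norm v * (1 + norm z) * C * (1 + norm z) ^ M) * (1 + norm u) ^ Suc M"
        by (simp only: power_Suc mult_ac)
    qed
    ultimately have "integrable lborel (\<lambda>u. ?A u - ?B u - ?E u)"
      by (intro Bochner_Integration.integrable_diff)
    moreover have "X v = (\<lambda>u. ?A u - ?B u - ?E u)"
      by (auto simp: X_def fun_eq_iff algebra_simps)
    ultimately show ?thesis by simp
  qed
  have \<sigma>2: "complex_of_real \<sigma> * complex_of_real \<sigma> = 1"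
    using abs_mult_self_eq[of \<sigma>] \<sigma> by (simp flip: of_real_mult)
  have "twisted_integral f (\<lambda>w. form \<sigma> v w * p w) (\<lambda>t. \<sigma> * a * \<phi> t - 2 * \<phi>' t) z
    = (LINT u|lborel. X v u + \<i> * of_real \<sigma> * X (J v) u - of_real (\<sigma> * a) * form \<sigma> v z * Y u)"
    unfolding twisted_integral_def
  proof (rule Bochner_Integration.integral_cong[OF refl])
    fix u
    define w where "w = u - z"
    have u: "J v \<bullet> u = J v \<bullet> w + J v \<bullet> z" "v \<bullet> u = v \<bullet> w + v \<bullet> z"
      by (auto simp: w_def inner_diff_right)
    show "f u * (twist z u * (form \<sigma> v (u - z) * p (u - z))) *
        complex_of_real (\<sigma> * a * \<phi> ((norm (u - z))\<^sup>2) - 2 * \<phi>' ((norm (u - z))\<^sup>2)) =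
        X v u + \<i> * of_real \<sigma> * X (J v) u - of_real (\<sigma> * a) * form \<sigma> v z * Y u"
      unfolding X_def Y_def w_def[symmetric] form_eq D(3) J_J inner_minus_left u of_real_mult of_real_diff
        of_real_minus of_real_add of_real_numeral
      using \<sigma>2 i_squared by algebra
  qed
  also have "\<dots> = 0"
    using X_int Y_int zero[OF z] X_zero
    by (simp add: twisted_integral_def flip: Y_def)
  finally show ?thesis .
qed

end

section \<open>Absorbing antiholomorphic forms\<close>

context twisted_space begin

lemma admissible_lincomb:
  assumes "admissible s \<phi>" "admissible s \<psi>"
  shows "admissible s (\<lambda>t. c * \<phi> t + d * \<psi> t)"
proof -
  obtain C1 N1 b1 where 1: "0 \<le> b1" "b1 < a / 2"
    "\<And>t. t \<ge> 0 \<Longrightarrow> \<bar>\<phi> t\<bar> \<le> C1 * (1 + t) ^ N1 * exp (b1 * t)"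
    using assms(1) unfolding admissible_def by auto
  obtain C2 N2 b2 where 2: "0 \<le> b2" "b2 < a / 2"
    "\<And>t. t \<ge> 0 \<Longrightarrow> \<bar>\<psi> t\<bar> \<le> C2 * (1 + t) ^ N2 * exp (b2 * t)"
    using assms(2) unfolding admissible_def by auto
  have C: "0 \<le> C1" "0 \<le> C2" using 1(3)[of 0] 2(3)[of 0] by simp_all
  have "\<bar>c * \<phi> t + d * \<psi> t\<bar> \<le> (\<bar>c\<bar> * C1 + \<bar>d\<bar> * C2) * (1 + t) ^ (N1 + N2) * exp (max b1 b2 * t)"
    if t: "0 \<le> t" for t
  proof -
    let ?E = "(1 + t) ^ (N1 + N2) * exp (max b1 b2 * t)"
    have "(1 + t) ^ N1 * exp (b1 * t) \<le> ?E" "(1 + t) ^ N2 * exp (b2 * t) \<le> ?E"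
      using t by (auto intro!: mult_mono power_increasing mult_right_mono)
    then have "\<bar>\<phi> t\<bar> \<le> C1 * ?E" "\<bar>\<psi> t\<bar> \<le> C2 * ?E"
      using 1(3)[OF t] 2(3)[OF t] mult_left_mono[OF _ C(1)] mult_left_mono[OF _ C(2)]
      by (fastforce simp: mult.assoc)+
    then have "\<bar>c\<bar> * \<bar>\<phi> t\<bar> \<le> \<bar>c\<bar> * (C1 * ?E)" "\<bar>d\<bar> * \<bar>\<psi> t\<bar> \<le> \<bar>d\<bar> * (C2 * ?E)"
      by (auto intro: mult_left_mono)
    then have "\<bar>c * \<phi> t + d * \<psi> t\<bar> \<le> \<bar>c\<bar> * (C1 * ?E) + \<bar>d\<bar> * (C2 * ?E)"
      using abs_triangle_ineq[of "c * \<phi> t" "d * \<psi> t"] by (simp add: abs_mult)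
    then show ?thesis by (simp add: algebra_simps)
  qed
  moreover have "0 \<le> max b1 b2" "max b1 b2 < a / 2" using 1 2 by auto
  moreover have "continuous_on UNIV (\<lambda>t. c * \<phi> t + d * \<psi> t)" "\<forall>t\<le>s. c * \<phi> t + d * \<psi> t = 0"
    using assms by (auto simp: admissible_def intro!: continuous_intros)
  ultimately show ?thesis unfolding admissible_def by blast
qed

text \<open>The solution that vanishes up to \<open>s\<close> is \<open>- exp (- a t / 2) / 2\<close> times the integral of
  \<open>exp (a x / 2) \<psi> x\<close> from \<open>s\<close> to \<open>t\<close>. It grows no faster than \<open>\<psi>\<close>, up to one power of \<open>t\<close>. With the opposite
  sign of \<open>a\<close> the solution may grow like \<open>exp (a t / 2)\<close> and leave the admissible class, which is why
  holomorphic forms need the separate treatment below.\<close>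

lemma admissible_ode_solution:
  assumes \<psi>: "admissible s \<psi>" and s: "0 \<le> s"
  obtains \<phi> \<phi>' where "admissible s \<phi>" "admissible s \<phi>'"
    "\<And>t. (\<phi> has_real_derivative \<phi>' t) (at t)" "\<And>t. - a * \<phi> t - 2 * \<phi>' t = \<psi> t"
proof -
  have c\<psi>: "continuous_on UNIV \<psi>" and z\<psi>: "\<And>t. t \<le> s \<Longrightarrow> \<psi> t = 0"
    using \<psi> by (auto simp: admissible_def)
  obtain C N b where b: "0 \<le> b" "b < a / 2"
    and C: "\<And>t. t \<ge> 0 \<Longrightarrow> \<bar>\<psi> t\<bar> \<le> C * (1 + t) ^ N * exp (b * t)"
    using \<psi> unfolding admissible_def by auto
  have C0: "0 \<le> C" using C[of 0] by simp
  define g where "g t = exp (a / 2 * t) * \<psi> t" for t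
  have "continuous_on UNIV g"
    unfolding g_def[abs_def] by (intro continuous_intros c\<psi>)
  then have "\<exists>F. \<forall>x. -\<infinity> < ereal x \<longrightarrow> ereal x < \<infinity> \<longrightarrow> (F has_vector_derivative g x) (at x)"
    by (intro einterval_antiderivative) (auto simp: continuous_on_eq_continuous_at)
  then obtain F where F: "\<And>x. (F has_real_derivative g x) (at x)"
    by (auto simp: has_real_derivative_iff_has_vector_derivative)
  \<comment> \<open>The integral of \<open>g\<close> from \<open>s\<close> to \<open>t\<close>.\<close>
  define G where "G t = F t - F s" for t
  have dG: "(G has_real_derivative g x) (at x)" for x
    unfolding G_def[abs_def] using F[of x] by (auto intro!: derivative_eq_intros)
  have G0: "G t = 0" if "t \<le> s" for t
  proof (cases "t = s")
    case False
    then have "t < s" using that by simp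
    then obtain \<xi> where "t < \<xi>" "\<xi> < s" "G s - G t = (s - t) * g \<xi>"
      using MVT2[of t s G g] dG by blast
    then show ?thesis using z\<psi>[of \<xi>] by (simp add: g_def G_def)
  qed (simp add: G_def)
  have G_bound: "\<bar>G t\<bar> \<le> C * (1 + t) ^ Suc N * exp ((a / 2 + b) * t)" if t: "0 \<le> t" for t
  proof (cases "t \<le> s")
    case True
    then show ?thesis using G0 C0 t by simp
  next
    case False
    then obtain \<xi> where \<xi>: "s < \<xi>" "\<xi> < t" "G t - G s = (t - s) * g \<xi>"
      using MVT2[of s t G g] dG by (meson not_le)
    have x0: "0 \<le> \<xi>" using \<xi> s by simp
    have "\<bar>g \<xi>\<bar> \<le> exp (a / 2 * \<xi>) * (C * (1 + \<xi>) ^ N * exp (b * \<xi>))"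
      unfolding g_def abs_mult abs_exp_cancel by (intro mult_left_mono C x0) simp
    also have "\<dots> \<le> exp (a / 2 * t) * (C * (1 + t) ^ N * exp (b * t))"
      using \<xi> x0 C0 b a_pos by (intro mult_mono power_mono) (auto intro: mult_left_mono)
    finally have "(t - s) * \<bar>g \<xi>\<bar> \<le> (1 + t) * (exp (a / 2 * t) * (C * (1 + t) ^ N * exp (b * t)))"
      using s t False by (intro mult_mono) auto
    also have "\<dots> = C * (1 + t) ^ Suc N * exp ((a / 2 + b) * t)"
      unfolding distrib_right[of "a / 2"] exp_add by (simp only: power_Suc mult_ac)
    finally show ?thesis
      using \<xi>(3) False G0[of s] by (simp add: abs_mult)
  qed
  define \<phi> where "\<phi> t = - (1 / 2) * exp (- (a / 2 * t)) * G t" for t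
  define \<phi>' where "\<phi>' t = - (a / 2) * \<phi> t + - (1 / 2) * \<psi> t" for t
  have d\<phi>: "(\<phi> has_real_derivative \<phi>' t) (at t)" for t
  proof -
    have "((\<lambda>t. exp (- (a / 2 * t))) has_real_derivative - (a / 2) * exp (- (a / 2 * t))) (at t)"
      by (auto intro!: derivative_eq_intros)
    from DERIV_mult[OF DERIV_cmult[OF this, of "- (1 / 2)"] dG]
    have "(\<phi> has_real_derivative (- (1 / 2) * (- (a / 2) * exp (- (a / 2 * t)))) * G t +
        g t * (- (1 / 2) * exp (- (a / 2 * t)))) (at t)"
      unfolding \<phi>_def[abs_def] .
    moreover have "exp (- (a / 2 * t)) * g t = \<psi> t"
      by (simp add: g_def flip: exp_add mult.assoc)
    ultimately show ?thesis by (simp add: \<phi>'_def \<phi>_def mult_ac)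
  qed
  have "admissible s \<phi>"
    unfolding admissible_def
  proof (intro conjI exI allI impI)
    show "continuous_on UNIV \<phi>"
      using DERIV_isCont[OF d\<phi>] by (simp add: continuous_at_imp_continuous_on)
    show "\<phi> t = 0" if "t \<le> s" for t using G0[OF that] by (simp add: \<phi>_def)
    show "0 \<le> b" "b < a / 2" by (fact b)+
    fix t :: real assume t: "0 \<le> t"
    have "\<bar>\<phi> t\<bar> = 1 / 2 * exp (- (a / 2 * t)) * \<bar>G t\<bar>"
      by (simp add: \<phi>_def abs_mult)
    also have "\<dots> \<le> 1 / 2 * exp (- (a / 2 * t)) * (C * (1 + t) ^ Suc N * exp ((a / 2 + b) * t))"
      by (intro mult_left_mono G_bound t) simp
    also have "\<dots> = C / 2 * (1 + t) ^ Suc N * exp (b * t)"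
    proof -
      have "exp (- (a / 2 * t)) * exp ((a / 2 + b) * t) = exp (b * t)"
        by (simp add: distrib_right flip: exp_add)
      then show ?thesis by (metis (no_types, opaque_lifting) mult.assoc mult.left_commute times_divide_eq_left mult_1_left)
    qed
    finally show "\<bar>\<phi> t\<bar> \<le> C / 2 * (1 + t) ^ Suc N * exp (b * t)" .
  qed
  moreover from this have "admissible s \<phi>'"
    unfolding \<phi>'_def[abs_def] by (intro admissible_lincomb \<psi>)
  moreover have "- a * \<phi> t - 2 * \<phi>' t = \<psi> t" for t
    by (simp add: \<phi>'_def algebra_simps)
  ultimately show thesis using that d\<phi> by blast
qed

text \<open>All twisted means over spheres around \<open>z\<close> that enclose the ball of radius \<open>r\<close> vanish, expressed by
  testing with profiles.\<close>

definition exterior_null :: "real \<Rightarrow> ('a \<Rightarrow> complex) \<Rightarrow> bool"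
  where "exterior_null r f \<longleftrightarrow> (\<forall>\<rho> z \<phi>. norm z < \<rho> - r \<longrightarrow> admissible (\<rho>\<^sup>2) \<phi> \<longrightarrow>
    twisted_integral f (\<lambda>_. 1) \<phi> z = 0)"

lemma rapid_mult_form:
  assumes f: "rapid f" and \<sigma>: "\<bar>\<sigma>\<bar> = 1"
  shows "rapid (\<lambda>u. form \<sigma> v u * f u)"
  unfolding rapid_def
proof (intro conjI allI)
  show "continuous_on UNIV (\<lambda>u. form \<sigma> v u * f u)"
    using f by (intro continuous_on_mult continuous_form continuous_on_id) (simp add: rapid_def)
  fix k
  obtain C where C: "\<And>u. norm (f u) * (1 + norm u) ^ Suc k * exp (a / 2 * (norm u)\<^sup>2) \<le> C"
    using f unfolding rapid_def by blast
  have "norm (form \<sigma> v u * f u) * (1 + norm u) ^ k * exp (a / 2 * (norm u)\<^sup>2) \<le> 2 * norm v * C" for u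
  proof -
    have "norm (form \<sigma> v u) \<le> 2 * norm v * (1 + norm u)"
      using norm_form[OF \<sigma>, of v u] by (simp add: algebra_simps add_increasing)
    then have "norm (form \<sigma> v u) * (norm (f u) * (1 + norm u) ^ k * exp (a / 2 * (norm u)\<^sup>2))
        \<le> (2 * norm v * (1 + norm u)) * (norm (f u) * (1 + norm u) ^ k * exp (a / 2 * (norm u)\<^sup>2))"
      by (rule mult_right_mono) simp
    also have "\<dots> = 2 * norm v * (norm (f u) * (1 + norm u) ^ Suc k * exp (a / 2 * (norm u)\<^sup>2))"
      by (simp only: power_Suc mult_ac)
    also have "\<dots> \<le> 2 * norm v * C"
      by (intro mult_left_mono C) simp
    finally show ?thesis by (simp only: norm_mult mult_ac)
  qed
  then show "\<exists>C. \<forall>u. norm (form \<sigma> v u * f u) * (1 + norm u) ^ k * exp (a / 2 * (norm u)\<^sup>2) \<le> C"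
    by blast
qed

text \<open>The rule with \<open>\<sigma> = -1\<close> and \<open>p = 1\<close> replaces \<open>\<phi>\<close> by \<open>- a \<phi> - 2 \<phi>'\<close>, and every admissible profile has this
  form. So an antiholomorphic form can be absorbed into \<open>f\<close> without losing the hypothesis.\<close>

lemma exterior_null_mult_form:
  assumes r: "0 \<le> r" and f: "rapid f" and null: "exterior_null r f"
  shows "exterior_null r (\<lambda>u. form (-1) v u * f u)"
  unfolding exterior_null_def
proof (intro allI impI)
  fix \<rho> and z :: 'a and \<psi> assume z: "norm z < \<rho> - r" and \<psi>: "admissible (\<rho>\<^sup>2) \<psi>"
  obtain \<phi> \<phi>' where \<phi>: "admissible (\<rho>\<^sup>2) \<phi>" "admissible (\<rho>\<^sup>2) \<phi>'"
    "\<And>t. (\<phi> has_real_derivative \<phi>' t) (at t)" "\<And>t. - a * \<phi> t - 2 * \<phi>' t = \<psi> t"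
    using admissible_ode_solution[OF \<psi>] by auto
  have "twisted_integral f (\<lambda>w. form (-1) v w * 1) (\<lambda>t. -1 * a * \<phi> t - 2 * \<phi>' t) z = 0"
    using null \<phi>(1) z
    by (intro twisted_integral_mult_form[OF f \<phi>(1-3) _ cr_poly_1, where R = "\<rho> - r"]) (auto simp: exterior_null_def)
  then have "twisted_integral f (form (-1) v) \<psi> z = 0"
    using \<phi>(4) by simp
  moreover have "twisted_integral f (\<lambda>_. 1) \<psi> z = 0"
    using null z \<psi> by (auto simp: exterior_null_def)
  moreover have "twisted_integral f (form (-1) v) \<psi> z =
    twisted_integral (\<lambda>u. form (-1) v u * f u) (\<lambda>_. 1) \<psi> z - form (-1) v z * twisted_integral f (\<lambda>_. 1) \<psi> z"
  proof -
    have int: "integrable lborel (\<lambda>u. h u * (twist z u * 1) * complex_of_real (\<psi> ((norm (u - z))\<^sup>2)))"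
      if "rapid h" for h
    proof (rule rapid_integrable[OF that \<psi>])
      show "continuous_on UNIV (\<lambda>u. twist z u * 1)" by (simp add: continuous_twist)
      show "norm (twist z u * 1) \<le> 1 * (1 + norm u) ^ 0" for u by simp
    qed
    have "rapid (\<lambda>u. form (-1) v u * f u)" by (rule rapid_mult_form[OF f]) simp
    note i = int[OF this] integrable_mult_right[OF int[OF f], of "form (-1) v z"]
    have "twisted_integral f (form (-1) v) \<psi> z = (LINT u|lborel.
        (form (-1) v u * f u) * (twist z u * 1) * complex_of_real (\<psi> ((norm (u - z))\<^sup>2)) -
        form (-1) v z * (f u * (twist z u * 1) * complex_of_real (\<psi> ((norm (u - z))\<^sup>2))))"
      unfolding twisted_integral_def form_diff
      by (rule Bochner_Integration.integral_cong) (auto simp: algebra_simps)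
    then show ?thesis
      unfolding Bochner_Integration.integral_diff[OF i] by (simp add: twisted_integral_def)
  qed
  ultimately show "twisted_integral (\<lambda>u. form (-1) v u * f u) (\<lambda>_. 1) \<psi> z = 0" by simp
qed

end

section \<open>Inserting holomorphic forms at the origin\<close>

lemma has_real_derivative_ramp_power:
  fixes s t :: real
  shows "((\<lambda>t. max 0 (t - s) ^ Suc (Suc m)) has_real_derivative
    real (Suc (Suc m)) * max 0 (t - s) ^ Suc m) (at t)"
proof -
  consider "t < s" | "t > s" | "t = s" by linarith
  then show ?thesis
  proof cases
    case 1
    have "((\<lambda>t. 0) has_real_derivative real (Suc (Suc m)) * max 0 (t - s) ^ Suc m) (at t)"
      using 1 by simp
    then show ?thesis
      by (rule has_field_derivative_transform_within_open[where S = "{..<s}"]) (use 1 in auto)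
  next
    case 2
    have "((\<lambda>t. (t - s) ^ Suc (Suc m)) has_real_derivative real (Suc (Suc m)) * max 0 (t - s) ^ Suc m) (at t)"
    proof -
      have "((\<lambda>t. t - s) has_real_derivative 1) (at t)" by (auto intro!: derivative_eq_intros)
      from DERIV_power[OF this, of "Suc (Suc m)"] show ?thesis using 2 by (simp del: power_Suc)
    qed
    then show ?thesis
      by (rule has_field_derivative_transform_within_open[where S = "{s<..}"]) (use 2 in auto)
  next
    case 3
    have "isCont (\<lambda>h. max 0 h ^ Suc m) (0::real)" by (intro continuous_intros)
    then have "((\<lambda>h. max 0 h ^ Suc m) \<longlongrightarrow> 0) (at (0::real))" by (simp add: isCont_def)
    then have "((\<lambda>h. (max 0 (t + h - s) ^ Suc (Suc m) - max 0 (t - s) ^ Suc (Suc m)) / h) \<longlongrightarrow> 0) (at 0)"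
      by (rule Lim_transform_eventually)
         (auto simp: 3 eventually_at_filter max_def intro!: always_eventually)
    then show ?thesis by (simp add: 3 DERIV_def)
  qed
qed

context twisted_space begin

text \<open>The profile after \<open>k\<close> applications of \<open>\<phi> \<mapsto> a \<phi> - 2 \<phi>'\<close> to \<open>(t - s)\<^sub>+\<^sup>N exp ((a - c) t / 2)\<close>. One application
  sends the function for \<open>N\<close> to \<open>c\<close> times itself minus \<open>2 N\<close> times the function for \<open>N - 1\<close>. The
  parameter \<open>c > 0\<close> keeps the growth subcritical and finally tends to \<open>0\<close>.\<close>

primrec lowered_profile :: "real \<Rightarrow> real \<Rightarrow> nat \<Rightarrow> nat \<Rightarrow> real \<Rightarrow> real"
  where
    "lowered_profile c s 0 N t = max 0 (t - s) ^ N * exp ((a - c) / 2 * t)"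
  | "lowered_profile c s (Suc k) N t = c * lowered_profile c s k N t - 2 * real N * lowered_profile c s k (N - 1) t"

lemma lowered_profile_derivative:
  assumes "k + 2 \<le> N"
  shows "(lowered_profile c s k N has_real_derivative
    (a - c) / 2 * lowered_profile c s k N t + real N * lowered_profile c s k (N - 1) t) (at t)"
  using assms
proof (induction k arbitrary: N)
  case 0
  then obtain m where N: "N = Suc (Suc m)" by (metis Suc_diff_le add_0 le_Suc_ex plus_nat.simps add_2_eq_Suc)
  have eq: "lowered_profile c s 0 N = (\<lambda>t. max 0 (t - s) ^ N * exp ((a - c) / 2 * t))" by auto
  have "((\<lambda>t. exp ((a - c) / 2 * t)) has_real_derivative (a - c) / 2 * exp ((a - c) / 2 * t)) (at t)"
    by (auto intro!: derivative_eq_intros)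
  from DERIV_mult[OF has_real_derivative_ramp_power[of s m t] this] show ?case
    unfolding eq unfolding N by (rule DERIV_cong) (simp del: power_Suc add: mult_ac)
next
  case (Suc k)
  have eq: "lowered_profile c s (Suc k) N = (\<lambda>t. c * lowered_profile c s k N t - 2 * real N * lowered_profile c s k (N - 1) t)"
    by auto
  have "k + 2 \<le> N" "k + 2 \<le> N - 1" and N: "real (N - 1) = real N - 1"
    using Suc.prems by (auto simp: of_nat_diff)
  from DERIV_diff[OF DERIV_cmult[OF Suc.IH[OF this(1)], of c] DERIV_cmult[OF Suc.IH[OF this(2)], of "2 * real N"]]
  show ?case
    unfolding eq by (rule DERIV_cong) (simp add: N algebra_simps)
qed

lemma admissible_lowered_profile:
  assumes "0 < c" "c \<le> a" "0 \<le> s" "k < N"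
  shows "admissible s (lowered_profile c s k N)"
  using assms(4)
proof (induction k arbitrary: N)
  case 0
  show ?case
    unfolding admissible_def
  proof (intro conjI exI allI impI)
    show "continuous_on UNIV (lowered_profile c s 0 N)"
      unfolding lowered_profile.simps[abs_def] by (intro continuous_intros)
    show "lowered_profile c s 0 N t = 0" if "t \<le> s" for t using that 0 by simp
    show "0 \<le> (a - c) / 2" "(a - c) / 2 < a / 2" using assms by auto
    show "\<bar>lowered_profile c s 0 N t\<bar> \<le> 1 * (1 + t) ^ N * exp ((a - c) / 2 * t)" if "0 \<le> t" for t
      using that assms by (auto simp: abs_mult intro!: mult_right_mono power_mono)
  qed
next
  case (Suc k)
  have "lowered_profile c s (Suc k) N = (\<lambda>t. c * lowered_profile c s k N t + (- 2 * real N) * lowered_profile c s k (N - 1) t)"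
    by auto
  then show ?case
    using Suc.prems by (elim ssubst) (intro admissible_lincomb Suc.IH; simp)
qed

text \<open>For \<open>c = 0\<close> only the terms that lower the power survive.\<close>

lemma lowered_profile_0: "\<exists>A. A \<noteq> 0 \<and> (\<forall>t. lowered_profile 0 s k (k + m) t = A * (max 0 (t - s) ^ m * exp (a / 2 * t)))"
proof (induction k)
  case 0
  show ?case by (rule exI[of _ 1]) simp
next
  case (Suc k)
  then obtain A where A: "A \<noteq> 0" "\<And>t. lowered_profile 0 s k (k + m) t = A * (max 0 (t - s) ^ m * exp (a / 2 * t))"
    by blast
  have "- 2 * real (Suc k + m) * A \<noteq> 0"
    using A(1) by (simp only: mult_eq_0_iff of_nat_eq_0_iff) simp
  moreover have "lowered_profile 0 s (Suc k) (Suc k + m) t =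
      - 2 * real (Suc k + m) * A * (max 0 (t - s) ^ m * exp (a / 2 * t))" for t
    using A(2)[of t] by (simp add: algebra_simps)
  ultimately show ?case by blast
qed

lemma lowered_profile_bound:
  assumes "0 \<le> s"
  shows "\<exists>A\<ge>0. \<forall>c t. 0 \<le> c \<longrightarrow> c \<le> a \<longrightarrow> 0 \<le> t \<longrightarrow> \<bar>lowered_profile c s k N t\<bar> \<le> A * (1 + t) ^ N * exp (a / 2 * t)"
proof (induction k arbitrary: N)
  case 0
  have "\<bar>lowered_profile c s 0 N t\<bar> \<le> 1 * (1 + t) ^ N * exp (a / 2 * t)" if "0 \<le> c" "c \<le> a" "0 \<le> t" for c t
    using that assms by (auto simp: abs_mult intro!: mult_mono power_mono mult_right_mono)
  then show ?case by (intro exI[of _ 1]) auto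
next
  case (Suc k)
  obtain A B where A: "A \<ge> 0" "\<And>c t. 0 \<le> c \<Longrightarrow> c \<le> a \<Longrightarrow> 0 \<le> t \<Longrightarrow> \<bar>lowered_profile c s k N t\<bar> \<le> A * (1 + t) ^ N * exp (a / 2 * t)"
    and B: "B \<ge> 0" "\<And>c t. 0 \<le> c \<Longrightarrow> c \<le> a \<Longrightarrow> 0 \<le> t \<Longrightarrow> \<bar>lowered_profile c s k (N - 1) t\<bar> \<le> B * (1 + t) ^ (N - 1) * exp (a / 2 * t)"
    using Suc.IH[of N] Suc.IH[of "N - 1"] by metis
  have "\<bar>lowered_profile c s (Suc k) N t\<bar> \<le> (a * A + 2 * real N * B) * (1 + t) ^ N * exp (a / 2 * t)"
    if c: "0 \<le> c" "c \<le> a" and t: "0 \<le> t" for c t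
  proof -
    let ?E = "(1 + t) ^ N * exp (a / 2 * t)"
    have 1: "\<bar>lowered_profile c s k N t\<bar> \<le> A * ?E" using A(2)[OF c t] by (simp add: mult.assoc)
    have "B * ((1 + t) ^ (N - 1) * exp (a / 2 * t)) \<le> B * ?E"
      using t B by (intro mult_left_mono mult_right_mono power_increasing) auto
    then have 2: "\<bar>lowered_profile c s k (N - 1) t\<bar> \<le> B * ?E" using B(2)[OF c t] by (simp add: mult.assoc)
    have "\<bar>lowered_profile c s (Suc k) N t\<bar> \<le> c * \<bar>lowered_profile c s k N t\<bar> + 2 * real N * \<bar>lowered_profile c s k (N - 1) t\<bar>"
      using c by (simp add: abs_mult order_trans[OF abs_triangle_ineq4])
    also have "\<dots> \<le> a * (A * ?E) + 2 * real N * (B * ?E)"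
      using c A t a_pos by (intro add_mono mult_mono 1 2 mult_left_mono) auto
    finally show ?thesis by (simp only: distrib_right mult.assoc)
  qed
  then show ?case using A B a_pos by (intro exI[of _ "a * A + 2 * real N * B"]) auto
qed

lemma lowered_profile_continuous: "continuous_on UNIV (\<lambda>c. lowered_profile c s k N t)"
  by (induction k arbitrary: N) (auto intro!: continuous_intros)

definition hol_monomial :: "'a list \<Rightarrow> 'a \<Rightarrow> complex"
  where "hol_monomial vs w = prod_list (map (\<lambda>v. form 1 v w) vs)"

lemma cr_poly_hol_monomial: "cr_poly 1 (hol_monomial vs)"
proof (induction vs)
  case Nil
  show ?case using cr_poly_1 by (simp add: hol_monomial_def[abs_def])
next
  case (Cons v vs)
  then show ?case using cr_poly_mult_form[of 1 "hol_monomial vs" v] by (simp add: hol_monomial_def[abs_def])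
qed

text \<open>Iterates the rule with \<open>\<sigma> = 1\<close>, one holomorphic form at a time. Each step lowers the power of the
  ramp by one, and the differentiated profile must be continuously differentiable, whence
  \<open>length vs < N\<close>.\<close>

lemma twisted_integral_lowered_profile:
  assumes r: "0 \<le> r" and f: "rapid f" and null: "exterior_null r f" and c: "0 < c" "c \<le> a"
    and N: "length vs < N" and z: "norm z < \<rho> - r"
  shows "twisted_integral f (hol_monomial vs) (lowered_profile c (\<rho>\<^sup>2) (length vs) N) z = 0"
  using N z
proof (induction vs arbitrary: N z)
  case Nil
  have "hol_monomial [] = (\<lambda>_. 1)"
    by (simp add: hol_monomial_def[abs_def])
  moreover have "admissible (\<rho>\<^sup>2) (lowered_profile c (\<rho>\<^sup>2) (length ([] :: 'a list)) N)"
    using Nil by (intro admissible_lowered_profile c) auto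
  ultimately show ?case
    using null Nil.prems(2) unfolding exterior_null_def by metis
next
  case (Cons v vs)
  let ?\<phi> = "lowered_profile c (\<rho>\<^sup>2) (length vs)"
  have "twisted_integral f (\<lambda>w. form 1 v w * hol_monomial vs w)
    (\<lambda>t. 1 * a * ?\<phi> N t - 2 * ((a - c) / 2 * ?\<phi> N t + real N * ?\<phi> (N - 1) t)) z = 0"
    using Cons.prems
    by (intro twisted_integral_mult_form[OF f _ _ _ _ cr_poly_hol_monomial, where s = "\<rho>\<^sup>2" and R = "\<rho> - r"] Cons.IH lowered_profile_derivative
         admissible_lincomb admissible_lowered_profile c) auto
  moreover have "hol_monomial (v # vs) = (\<lambda>w. form 1 v w * hol_monomial vs w)"
    by (simp add: hol_monomial_def[abs_def])
  moreover have "lowered_profile c (\<rho>\<^sup>2) (length (v # vs)) N =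
    (\<lambda>t. 1 * a * ?\<phi> N t - 2 * ((a - c) / 2 * ?\<phi> N t + real N * ?\<phi> (N - 1) t))"
    by (rule ext) (simp add: field_simps)
  ultimately show ?case by simp
qed

text \<open>Here the full decay of \<open>f\<close> is used. At the centre \<open>z = 0\<close> the integrals stay dominated as \<open>c\<close> tends to
  \<open>0\<close>, although the profile reaches the critical growth \<open>exp (a t / 2)\<close>, because \<open>exp (a |u|\<^sup>2 / 2) f u\<close>
  decays faster than every power. In the limit the lowered profile is a nonzero multiple of the
  simple ramp, whatever the number of forms. Here \<open>N = length vs + 1\<close> leaves exactly the first power
  of the ramp.\<close>

lemma hol_moment_zero:
  assumes r: "0 \<le> r" and f: "rapid f" and null: "exterior_null r f" and \<rho>: "r < \<rho>"
  shows "has_bochner_integral lborel (\<lambda>u. f u * hol_monomial vs u *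
    of_real (max 0 ((norm u)\<^sup>2 - \<rho>\<^sup>2) * exp (a / 2 * (norm u)\<^sup>2))) 0"
proof -
  let ?k = "length vs"
  define \<phi> where "\<phi> c = lowered_profile c (\<rho>\<^sup>2) ?k (Suc ?k)" for c
  obtain A where A: "A \<noteq> 0" "\<And>t. \<phi> 0 t = A * (max 0 (t - \<rho>\<^sup>2) * exp (a / 2 * t))"
    using lowered_profile_0[of "\<rho>\<^sup>2" ?k 1] by (auto simp: \<phi>_def)
  obtain B where B: "B \<ge> 0" "\<And>c t. 0 \<le> c \<Longrightarrow> c \<le> a \<Longrightarrow> 0 \<le> t \<Longrightarrow>
      \<bar>\<phi> c t\<bar> \<le> B * (1 + t) ^ Suc ?k * exp (a / 2 * t)"
    using lowered_profile_bound[of "\<rho>\<^sup>2" ?k "Suc ?k"] unfolding \<phi>_def by auto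
  obtain C M where p: "\<And>w. norm (hol_monomial vs w) \<le> C * (1 + norm w) ^ M"
    and p_cont: "continuous_on UNIV (hol_monomial vs)"
    using cr_poly_hol_monomial[of vs] has_derivative_continuous continuous_at_imp_continuous_on
    unfolding cr_poly_def by metis
  have C: "0 \<le> C" using order_trans[OF norm_ge_zero p[of 0]] by simp
  define K where "K = M + 2 * Suc ?k"
  obtain D where D: "\<And>u. norm (f u) * (1 + norm u) ^ (K + Suc DIM('a)) * exp (a / 2 * (norm u)\<^sup>2) \<le> D"
    using f unfolding rapid_def by blast
  define c where "c n = a / real (Suc n)" for n
  have c: "0 < c n" "c n \<le> a" for n using a_pos by (auto simp: c_def field_simps)
  have c0: "c \<longlonglongrightarrow> 0" unfolding c_def by (rule LIMSEQ_Suc, rule lim_const_over_n)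
  define S where "S n u = f u * hol_monomial vs u * complex_of_real (\<phi> (c n) ((norm u)\<^sup>2))" for n u
  define S0 where "S0 u = f u * hol_monomial vs u * complex_of_real (\<phi> 0 ((norm u)\<^sup>2))" for u
  have "integral\<^sup>L lborel (S n) = 0" for n
    using twisted_integral_lowered_profile[OF r f null c, of vs "Suc ?k" 0 \<rho> n] \<rho>
      linear_0[OF linear_J]
    by (simp add: twisted_integral_def twist_def S_def[abs_def] \<phi>_def)
  moreover have "integrable lborel S0 \<and> (\<lambda>n. integral\<^sup>L lborel (S n)) \<longlonglongrightarrow> integral\<^sup>L lborel S0"
  proof -
    have "integrable lborel (S n)" for n
      unfolding S_def[abs_def]
      using rapid_integrable[OF f admissible_lowered_profile[OF c] p_cont p, of "\<rho>\<^sup>2" ?k "Suc ?k" n 0]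
      by (simp add: \<phi>_def)
    then have S_meas: "S n \<in> borel_measurable lborel" for n by (rule borel_measurable_integrable)
    have lim: "(\<lambda>n. S n u) \<longlonglongrightarrow> S0 u" for u
    proof -
      have "(\<lambda>n. \<phi> (c n) ((norm u)\<^sup>2)) \<longlonglongrightarrow> \<phi> 0 ((norm u)\<^sup>2)"
        unfolding \<phi>_def
        by (rule continuous_on_tendsto_compose[OF lowered_profile_continuous c0]) auto
      then show ?thesis unfolding S_def S0_def by (intro tendsto_mult tendsto_const tendsto_of_real)
    qed
    have S0_meas: "S0 \<in> borel_measurable lborel"
      by (rule borel_measurable_LIMSEQ_metric[OF S_meas lim])
    have w: "integrable lborel (\<lambda>u. C * B * D * weight u)"
      by (intro integrable_mult_right weight_integrable)
    have dom: "norm (S n u) \<le> C * B * D * weight u" for n u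
    proof -
      let ?x = "norm u"
      have "1 + ?x\<^sup>2 \<le> (1 + ?x)\<^sup>2" by (simp add: power2_eq_square algebra_simps)
      then have "(1 + ?x\<^sup>2) ^ Suc ?k \<le> ((1 + ?x)\<^sup>2) ^ Suc ?k" by (intro power_mono) auto
      then have "B * (1 + ?x\<^sup>2) ^ Suc ?k * exp (a / 2 * ?x\<^sup>2) \<le> B * (1 + ?x) ^ (2 * Suc ?k) * exp (a / 2 * ?x\<^sup>2)"
        unfolding power_mult using B by (intro mult_right_mono mult_left_mono) auto
      then have \<phi>: "\<bar>\<phi> (c n) (?x\<^sup>2)\<bar> \<le> B * (1 + ?x) ^ (2 * Suc ?k) * exp (a / 2 * ?x\<^sup>2)"
        using B(2)[of "c n" "?x\<^sup>2"] c[of n] by simp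
      have "norm (S n u) = norm (f u) * norm (hol_monomial vs u) * \<bar>\<phi> (c n) (?x\<^sup>2)\<bar>"
        by (simp add: S_def norm_mult)
      also have "\<dots> \<le> norm (f u) * (C * (1 + ?x) ^ M) * (B * (1 + ?x) ^ (2 * Suc ?k) * exp (a / 2 * ?x\<^sup>2))"
        using C B by (intro mult_mono mult_left_mono p \<phi>) auto
      also have "\<dots> = C * B * (norm (f u) * (1 + ?x) ^ K * exp (a / 2 * ?x\<^sup>2))"
        unfolding K_def power_add by (simp only: mult_ac)
      also have "\<dots> = C * B * (norm (f u) * (1 + ?x) ^ (K + Suc DIM('a)) * exp (a / 2 * ?x\<^sup>2)) * weight u"
        unfolding one_plus_norm_power_weight[of u K, symmetric] by (simp only: mult_ac)
      also have "\<dots> \<le> C * B * D * weight u"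
        using C B by (intro mult_right_mono mult_left_mono D) auto
      finally show ?thesis .
    qed
    have lim_AE: "AE u in lborel. (\<lambda>n. S n u) \<longlonglongrightarrow> S0 u"
      and dom_AE: "AE u in lborel. norm (S n u) \<le> C * B * D * weight u" for n
      using lim dom by simp_all
    show ?thesis
      using integrable_dominated_convergence[OF S0_meas S_meas w lim_AE dom_AE]
        integral_dominated_convergence[OF S0_meas S_meas w lim_AE dom_AE] by simp
  qed
  ultimately have "has_bochner_integral lborel S0 0"
    by (simp add: LIMSEQ_const_iff has_bochner_integral_iff)
  then have "has_bochner_integral lborel (\<lambda>u. inverse (of_real A) * S0 u) (inverse (of_real A) * 0)"
    by (intro has_bochner_integral_mult_right)
  moreover have "(\<lambda>u. inverse (of_real A) * S0 u) = (\<lambda>u. f u * hol_monomial vs u *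
    of_real (max 0 ((norm u)\<^sup>2 - \<rho>\<^sup>2) * exp (a / 2 * (norm u)\<^sup>2)))"
    using A(1) by (auto simp: S0_def A(2))
  ultimately show ?thesis by simp
qed

end

section \<open>From moments to the support\<close>

lemma continuous_compact_support_integrable:
  fixes g :: "'a::euclidean_space \<Rightarrow> 'b::{banach, second_countable_topology}"
  assumes "continuous_on UNIV g" "\<And>u. u \<notin> cball 0 R \<Longrightarrow> g u = 0"
  shows "integrable lborel g"
proof -
  have "integrable lborel (\<lambda>u. indicator (cball 0 R) u *\<^sub>R g u)"
    by (rule borel_integrable_compact) (use assms(1) in \<open>auto intro: continuous_on_subset\<close>)
  moreover have "(\<lambda>u. indicator (cball 0 R) u *\<^sub>R g u) = g"
    using assms(2) by (auto simp: indicator_def)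
  ultimately show ?thesis by simp
qed

text \<open>By Stone-Weierstrass, \<open>F\<close> is orthogonal to all continuous functions, in particular to its own
  conjugate. Compact support is essential: rapidly decreasing functions are not determined by
  their moments.\<close>

lemma zero_if_polynomial_moments_zero:
  fixes F :: "'a::euclidean_space \<Rightarrow> complex"
  assumes F: "continuous_on UNIV F" and supp: "\<And>u. u \<notin> cball 0 R \<Longrightarrow> F u = 0"
    and zero: "\<And>p. real_polynomial_function p \<Longrightarrow> (LINT u|lborel. of_real (p u) * F u) = 0"
  shows "F u = 0"
proof -
  have F_int: "integrable lborel F"
    by (rule continuous_compact_support_integrable[OF F supp])
  have int: "integrable lborel (\<lambda>u. of_real (h u) * F u)" if "continuous_on UNIV h" for h :: "'a \<Rightarrow> real"
    by (rule continuous_compact_support_integrable[of _ R])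
       (use that F supp in \<open>auto intro!: continuous_on_mult continuous_on_of_real\<close>)
  have cont_zero: "(LINT u|lborel. of_real (h u) * F u) = 0" if h: "continuous_on UNIV h" for h :: "'a \<Rightarrow> real"
  proof (rule ccontr)
    let ?I = "LINT u|lborel. of_real (h u) * F u"
    let ?N = "LINT u|lborel. norm (F u)"
    assume "?I \<noteq> 0"
    have "0 \<le> ?N" by simp
    then have N: "0 < ?N + 1" by linarith
    define e where "e = norm ?I / (?N + 1)"
    have e: "e > 0" unfolding e_def using \<open>?I \<noteq> 0\<close> by (intro divide_pos_pos N) simp
    obtain p where p: "real_polynomial_function p" "\<And>x. x \<in> cball 0 R \<Longrightarrow> \<bar>h x - p x\<bar> < e"
      by (rule Stone_Weierstrass_real_polynomial_function[of "cball (0::'a) R" h e])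
         (use e h in \<open>auto intro: continuous_on_subset\<close>)
    have pc: "continuous_on UNIV p"
      using p(1) continuous_on_polymonial_function real_polynomial_function_eq by blast
    have "?I = ?I - (LINT u|lborel. of_real (p u) * F u)" using zero[OF p(1)] by simp
    also have "\<dots> = (LINT u|lborel. of_real (h u) * F u - of_real (p u) * F u)"
      by (rule Bochner_Integration.integral_diff[symmetric]) (intro int h pc)+
    finally have "norm ?I \<le> (LINT u|lborel. norm (of_real (h u) * F u - of_real (p u) * F u))"
      by simp
    also have "\<dots> \<le> (LINT u|lborel. e * norm (F u))"
    proof (rule integral_mono)
      show "integrable lborel (\<lambda>u. norm (of_real (h u) * F u - of_real (p u) * F u))"
        by (intro integrable_norm Bochner_Integration.integrable_diff int h pc)
      show "integrable lborel (\<lambda>u. e * norm (F u))"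
        by (intro integrable_mult_right integrable_norm F_int)
      fix u
      show "norm (of_real (h u) * F u - of_real (p u) * F u) \<le> e * norm (F u)"
      proof (cases "u \<in> cball 0 R")
        case True
        have "norm (of_real (h u) * F u - of_real (p u) * F u) = \<bar>h u - p u\<bar> * norm (F u)"
          by (simp flip: left_diff_distrib of_real_diff add: norm_mult)
        then show ?thesis using p(2)[OF True] by (simp add: mult_right_mono)
      qed (use supp in simp)
    qed
    also have "\<dots> = e * ?N" by simp
    also have "\<dots> < e * (?N + 1)" using e by simp
    also have "\<dots> = norm ?I" using N by (simp add: e_def)
    finally show False by simp
  qed
  have "(LINT u|lborel. complex_of_real ((norm (F u))\<^sup>2)) =
      (LINT u|lborel. of_real (Re (F u)) * F u - \<i> * (of_real (Im (F u)) * F u))"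
    by (rule Bochner_Integration.integral_cong)
       (simp_all add: complex_eq_iff cmod_power2 power2_eq_square[of "Re _"] power2_eq_square[of "Im _"])
  also have "\<dots> = (LINT u|lborel. of_real (Re (F u)) * F u) - (LINT u|lborel. \<i> * (of_real (Im (F u)) * F u))"
    using F by (intro Bochner_Integration.integral_diff integrable_mult_right int continuous_on_Re continuous_on_Im)
  also have "\<dots> = 0"
    using F by (simp add: cont_zero continuous_on_Re continuous_on_Im)
  finally have "(LINT u|lborel. (norm (F u))\<^sup>2) = 0" 
    by (simp only: integral_complex_of_real of_real_eq_0_iff)
  moreover have "integrable lborel (\<lambda>u. (norm (F u))\<^sup>2)"
    by (rule continuous_compact_support_integrable[of _ R])
       (use F supp in \<open>auto intro!: continuous_intros\<close>)
  ultimately have "AE u in lborel. (norm (F u))\<^sup>2 = 0"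
    by (subst (asm) integral_nonneg_eq_0_iff_AE) auto
  then have "AE u in lebesgue. u \<in> {u. F u = 0}"
    by (intro AE_completion) simp
  moreover have "closed {u. F u = 0}"
    using F by (intro closed_Collect_eq) auto
  ultimately show ?thesis using mem_closed_if_AE_lebesgue by blast
qed

context twisted_space begin

definition antihol_monomial :: "'a list \<Rightarrow> 'a \<Rightarrow> complex"
  where "antihol_monomial ws w = prod_list (map (\<lambda>v. form (-1) v w) ws)"

lemma rapid_exterior_null_antihol:
  assumes "0 \<le> r" "rapid f" "exterior_null r f"
  shows "rapid (\<lambda>u. antihol_monomial ws u * f u)" "exterior_null r (\<lambda>u. antihol_monomial ws u * f u)"
proof (induction ws)
  case Nil
  {
    case 1 show ?case using assms by (simp add: antihol_monomial_def)
  next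
    case 2 show ?case using assms by (simp add: antihol_monomial_def)
  }
next
  case (Cons w ws)
  have eq: "(\<lambda>u. antihol_monomial (w # ws) u * f u) = (\<lambda>u. form (-1) w u * (antihol_monomial ws u * f u))"
    by (auto simp: antihol_monomial_def)
  {
    case 1 show ?case unfolding eq by (rule rapid_mult_form[OF Cons(1)]) simp
  next
    case 2 show ?case unfolding eq by (rule exterior_null_mult_form[OF assms(1) Cons])
  }
qed

lemma continuous_monomials:
  "continuous_on UNIV (hol_monomial vs)" "continuous_on UNIV (antihol_monomial ws)"
proof -
  show "continuous_on UNIV (hol_monomial vs)"
    unfolding hol_monomial_def[abs_def]
    by (induction vs) (auto intro!: continuous_on_mult continuous_form continuous_on_id)
  show "continuous_on UNIV (antihol_monomial ws)"
    unfolding antihol_monomial_def[abs_def]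
    by (induction ws) (auto intro!: continuous_on_mult continuous_form continuous_on_id)
qed

text \<open>The vanishing of all mixed monomial moments is inherited when \<open>q\<close> is multiplied by a real linear
  form, since \<open>\<langle>v, u\<rangle>\<close> is half the sum of \<open>form 1 v u\<close> and \<open>form (-1) v u\<close>. Generalizing over the factor
  \<open>q\<close> makes the induction pass through products.\<close>

lemma polynomial_moments_zero:
  assumes F: "continuous_on UNIV F" and supp: "\<And>u. u \<notin> cball 0 R \<Longrightarrow> F u = 0"
    and zero: "\<And>ws vs. (LINT u|lborel. q u * (antihol_monomial ws u * hol_monomial vs u * F u)) = 0"
    and q: "continuous_on UNIV q" and p: "real_polynomial_function p"
  shows "(LINT u|lborel. (of_real (p u) * q u) * (antihol_monomial ws u * hol_monomial vs u * F u)) = 0"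
  using p zero q
proof (induction p arbitrary: q ws vs rule: real_polynomial_function.induct)
  case (linear l)
  have int: "integrable lborel (\<lambda>u. q u * (antihol_monomial ws u * hol_monomial vs u * F u))" for ws vs
    by (rule continuous_compact_support_integrable[of _ R])
       (use F supp linear in \<open>auto intro!: continuous_on_mult continuous_monomials\<close>)
  define v where "v = adjoint l 1"
  have l: "l u = v \<bullet> u" for u
    using adjoint_works[of l u 1] linear(1) by (simp add: v_def bounded_linear.linear inner_commute)
  have "(\<lambda>u. (of_real (l u) * q u) * (antihol_monomial ws u * hol_monomial vs u * F u)) =
      (\<lambda>u. (1 / 2) * (q u * (antihol_monomial ws u * hol_monomial (v # vs) u * F u)
        + q u * (antihol_monomial (v # ws) u * hol_monomial vs u * F u)))"
    by (auto simp: l hol_monomial_def antihol_monomial_def form_eq algebra_simps)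
  then show ?case
    using int linear(2) by (simp only: integral_mult_right_zero Bochner_Integration.integral_add) simp
next
  case (const c)
  then show ?case by (simp add: mult.assoc)
next
  case (add p1 p2)
  have "continuous_on UNIV p1" "continuous_on UNIV p2"
    using add(1,2) continuous_on_polymonial_function real_polynomial_function_eq by blast+
  then have int: "integrable lborel (\<lambda>u. (of_real (p1 u) * q u) * (antihol_monomial ws u * hol_monomial vs u * F u))"
    "integrable lborel (\<lambda>u. (of_real (p2 u) * q u) * (antihol_monomial ws u * hol_monomial vs u * F u))"
    by (auto intro!: continuous_compact_support_integrable[of _ R] continuous_on_mult continuous_monomials
        continuous_on_of_real add.prems F supp)
  show ?case
    using add.IH[OF add.prems] Bochner_Integration.integral_add[OF int]
    by (simp add: distrib_right)
next
  case (mult p1 p2)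
  have "continuous_on UNIV p2"
    using mult(2) continuous_on_polymonial_function real_polynomial_function_eq by blast
  then have "continuous_on UNIV (\<lambda>u. of_real (p2 u) * q u)"
    by (intro continuous_on_mult continuous_on_of_real mult.prems)
  from mult.IH(1)[OF mult.IH(2)[OF mult.prems] this] show ?case
    by (simp add: mult.assoc)
qed

text \<open>The second difference in \<open>s\<close> of the ramps \<open>(t - s)\<^sub>+\<close> is a hat function. Hence all mixed moments of
  \<open>f\<close> times a hat in \<open>|u|\<^sup>2\<close> vanish. This product has compact support, so it is zero, and the hat can
  be centred at any \<open>|x|\<^sup>2 > r\<^sup>2\<close>.\<close>

lemma vanishes_outside_ball:
  assumes r: "0 \<le> r" and f: "rapid f" and null: "exterior_null r f" and x: "r < norm x"
  shows "f x = 0"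
proof -
  define t0 where "t0 = (norm x)\<^sup>2"
  \<comment> \<open>The width \<open>h\<close> of the hat is chosen so that all three nodes \<open>t0 - h\<close>, \<open>t0\<close>, \<open>t0 + h\<close> exceed \<open>r\<^sup>2\<close>.\<close>
  define h where "h = (t0 - r\<^sup>2) / 2"
  have "r\<^sup>2 < t0" using r x by (simp add: t0_def power_strict_mono)
  then have h: "h > 0" and s1: "r\<^sup>2 < t0 - h" by (auto simp: h_def field_simps)
  define ramp where "ramp s u = complex_of_real (max 0 ((norm (u::'a))\<^sup>2 - s) * exp (a / 2 * (norm u)\<^sup>2))" for s u
  define hat where "hat t = max 0 (t - (t0 - h)) - 2 * max 0 (t - t0) + max 0 (t - (t0 + h))" for t
  define F where "F u = f u * complex_of_real (hat ((norm u)\<^sup>2) * exp (a / 2 * (norm u)\<^sup>2))" for u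
  have moments: "has_bochner_integral lborel (\<lambda>u. antihol_monomial ws u * hol_monomial vs u * (f u * ramp s u)) 0"
    if s: "r\<^sup>2 < s" for ws vs s
  proof -
    have "r < sqrt s" using r s by (simp add: real_less_rsqrt)
    moreover have "(sqrt s)\<^sup>2 = s" using s by (simp add: order_trans[OF zero_le_power2 less_imp_le[OF s]])
    ultimately show ?thesis
      using hol_moment_zero[OF r rapid_exterior_null_antihol[OF r f null, of ws], of "sqrt s" vs]
      by (simp add: ramp_def mult_ac)
  qed
  have "(LINT u|lborel. 1 * (antihol_monomial ws u * hol_monomial vs u * F u)) = 0" for ws vs
  proof -
    let ?m = "\<lambda>s u. antihol_monomial ws u * hol_monomial vs u * (f u * ramp s u)"
    have "has_bochner_integral lborel (\<lambda>u. ?m (t0 - h) u - 2 * ?m t0 u + ?m (t0 + h) u) (0 - 2 * 0 + 0)"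
      using s1 h by (intro has_bochner_integral_add has_bochner_integral_diff has_bochner_integral_mult_right moments) auto
    moreover have "(\<lambda>u. ?m (t0 - h) u - 2 * ?m t0 u + ?m (t0 + h) u) =
        (\<lambda>u. 1 * (antihol_monomial ws u * hol_monomial vs u * F u))"
      by (auto simp: F_def hat_def ramp_def algebra_simps)
    ultimately show ?thesis by (simp add: has_bochner_integral_integral_eq)
  qed
  moreover have F: "continuous_on UNIV F"
  proof -
    have "continuous_on UNIV f" using f by (simp add: rapid_def)
    then show ?thesis unfolding F_def[abs_def] hat_def by (intro continuous_intros)
  qed
  moreover have supp: "F u = 0" if "u \<notin> cball 0 (sqrt (t0 + h))" for u
  proof -
    have "sqrt (t0 + h) < norm u" using that by simp
    then have "t0 + h < (norm u)\<^sup>2"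
      using real_sqrt_less_iff by (smt (verit) norm_ge_zero real_sqrt_abs real_sqrt_le_iff abs_norm_cancel)
    then show ?thesis using h by (simp add: F_def hat_def)
  qed
  ultimately have "(LINT u|lborel. (of_real (p u) * 1) * (antihol_monomial [] u * hol_monomial [] u * F u)) = 0"
    if "real_polynomial_function p" for p
    using that by (intro polynomial_moments_zero[where R = "sqrt (t0 + h)"]) auto
  then have "(LINT u|lborel. of_real (p u) * F u) = 0" if "real_polynomial_function p" for p
    using that by (simp add: antihol_monomial_def hol_monomial_def)
  then have "F x = 0"
    using zero_if_polynomial_moments_zero[OF F supp] by blast
  moreover have "hat ((norm x)\<^sup>2) = h" using h by (simp add: hat_def t0_def)
  ultimately show ?thesis using h by (simp add: F_def)
qed

text \<open>Reflecting \<open>u = z - w\<close> and passing to polar coordinates in \<open>w\<close> makes the profile constant on each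
  sphere; it vanishes on the small spheres, and the means vanish on the large ones.\<close>

lemma exterior_null_if_spherical_means_zero:
  assumes r: "0 \<le> r" and f: "rapid f"
    and zero: "\<And>z \<sigma>. r + norm z < \<sigma> \<Longrightarrow>
      (LINT w:ball 0 1 - {0}|lborel. f (z - (\<sigma> / norm w) *\<^sub>R w) * cis (a * (z \<bullet> J ((\<sigma> / norm w) *\<^sub>R w)))) = 0"
  shows "exterior_null r f"
  unfolding exterior_null_def
proof (intro allI impI)
  fix \<rho> and z :: 'a and \<phi> assume z: "norm z < \<rho> - r" and \<phi>: "admissible (\<rho>\<^sup>2) \<phi>"
  define g where "g u = f u * (twist z u * 1) * complex_of_real (\<phi> ((norm (u - z))\<^sup>2))" for u
  have g_int: "integrable lborel g"
    unfolding g_def[abs_def]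
  proof (rule rapid_integrable[OF f \<phi>])
    show "continuous_on UNIV (\<lambda>u. twist z u * 1)" by (simp add: continuous_twist)
    show "norm (twist z u * 1) \<le> 1 * (1 + norm u) ^ 0" for u by simp
  qed
  have reflect: "lborel = distr lborel borel (\<lambda>w. z - w)"
    using lborel_affine[of "-1" z] by (simp add: density_1)
  have g_meas: "g \<in> borel_measurable borel" using borel_measurable_integrable[OF g_int] by simp
  have "integrable (distr lborel borel (\<lambda>w. z - w)) g" using g_int reflect by simp
  then have int: "integrable lborel (\<lambda>w. g (z - w))"
    by (subst (asm) integrable_distr_eq) (use g_meas in auto)
  have gw: "g (z - w) = complex_of_real (\<phi> ((norm w)\<^sup>2)) * (f (z - w) * cis (a * (z \<bullet> J w)))" for w
  proof -
    have "J z \<bullet> z = 0" using J_skew[of z z] by (simp add: inner_commute)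
    then have "J z \<bullet> (z - w) = z \<bullet> J w" by (simp add: inner_diff_right J_skew)
    then show ?thesis by (simp add: g_def twist_def)
  qed
  have "twisted_integral f (\<lambda>_. 1) \<phi> z = integral\<^sup>L lborel g"
    by (simp add: twisted_integral_def g_def[abs_def])
  also have "\<dots> = integral\<^sup>L (distr lborel borel (\<lambda>w. z - w)) g"
    using reflect by simp
  also have "\<dots> = integral\<^sup>L lborel (\<lambda>w. g (z - w))"
    by (rule integral_distr) (use g_meas in auto)
  also have "\<dots> = 0"
  proof (rule integral_eq_0_if_sphere_integrals_eq_0[OF int])
    fix \<sigma> :: real assume \<sigma>: "\<sigma> > 0"
    have "(LINT w:ball 0 1 - {0}|lborel. g (z - (\<sigma> / norm w) *\<^sub>R w)) =
      (LINT w:ball 0 1 - {0}|lborel. complex_of_real (\<phi> (\<sigma>\<^sup>2)) *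
        (f (z - (\<sigma> / norm w) *\<^sub>R w) * cis (a * (z \<bullet> J ((\<sigma> / norm w) *\<^sub>R w)))))"
      unfolding set_lebesgue_integral_def
      by (rule Bochner_Integration.integral_cong) (use \<sigma> in \<open>auto simp: gw indicator_def\<close>)
    also have "\<dots> = complex_of_real (\<phi> (\<sigma>\<^sup>2)) * (LINT w:ball 0 1 - {0}|lborel.
        (f (z - (\<sigma> / norm w) *\<^sub>R w) * cis (a * (z \<bullet> J ((\<sigma> / norm w) *\<^sub>R w)))))"
      unfolding set_lebesgue_integral_def mult_scaleR_right[symmetric] by (rule integral_mult_right_zero)
    also have "\<dots> = 0"
    proof (cases "\<sigma> \<le> \<rho>")
      case True
      then have "\<sigma>\<^sup>2 \<le> \<rho>\<^sup>2" using \<sigma> by (intro power_mono) auto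
      then show ?thesis using \<phi> by (simp add: admissible_def)
    next
      case False
      then show ?thesis using zero[of z \<sigma>] z by simp
    qed
    finally show "(LINT w:ball 0 1 - {0}|lborel. g (z - (\<sigma> / norm w) *\<^sub>R w)) = 0" .
  qed
  finally show "twisted_integral f (\<lambda>_. 1) \<phi> z = 0" .
qed

end

section \<open>The support theorem on the H-type group\<close>

text \<open>Normalization cancels the area factor and leaves the average over the unit ball of the radially
  projected integrand.\<close>

lemma integral_normalized_sphere_measure:
  fixes F :: "'a::euclidean_space \<Rightarrow> 'b::{banach, second_countable_topology}"
  assumes s: "s > 0" and F: "F \<in> borel_measurable borel"
  shows "integral\<^sup>L (normalized_sphere_measure s) F =
    (1 / measure lborel (ball (0::'a) 1)) *\<^sub>R (LINT w:ball 0 1 - {0}|lborel. F ((s / norm w) *\<^sub>R w))"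
proof -
  let ?B = "ball (0::'a) 1 - {0}" and ?S = "sphere (0::'a) s"
  let ?p = "\<lambda>w::'a. (s / norm w) *\<^sub>R w"
  define V where "V = measure lborel (ball (0::'a) 1)"
  define D where "D = distr (restrict_space lborel ?B) borel ?p"
  have p_meas: "?p \<in> measurable (restrict_space lborel ?B) borel"
    by (rule measurable_restrict_space1) measurable
  have D_sets: "sets D = sets borel" by (simp add: D_def)
  have finite_ball: "emeasure lborel (ball (0::'a) 1) < \<infinity>"
    by (rule emeasure_bounded_finite[OF bounded_ball])
  then have V: "emeasure lborel (ball (0::'a) 1) = ennreal V"
    unfolding V_def by (intro emeasure_eq_ennreal_measure) auto
  have V_pos: "V > 0"
    unfolding V_def by (simp add: content_ball_pos)
  have B: "emeasure lborel ?B = ennreal V"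
    using V by (subst emeasure_Diff_null_set) auto
  have DA: "emeasure D A = emeasure lborel (?p -` A \<inter> ?B)" if "A \<in> sets borel" for A
    unfolding D_def using that
    by (subst emeasure_distr[OF p_meas]) (simp_all add: space_restrict_space emeasure_restrict_space)
  have D_finite: "emeasure D A < \<infinity>" if "A \<in> sets borel" for A
  proof -
    have "emeasure lborel (?p -` A \<inter> ?B) \<le> emeasure lborel (ball (0::'a) 1)"
      by (rule emeasure_mono) auto
    then show ?thesis using finite_ball DA[OF that] by simp
  qed
  have DS: "emeasure D ?S = ennreal V"
  proof -
    have "?p -` ?S \<inter> ?B = ?B" using s by auto
    then show ?thesis using DA[of ?S] B by simp
  qed
  define c where "c = real DIM('a) * s ^ (DIM('a) - 1)"
  have c: "c > 0" using s by (simp add: c_def)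
  have "normalized_sphere_measure s = density D (\<lambda>_. ennreal (1 / V))"
  proof (rule measure_eqI)
    show "sets (normalized_sphere_measure s) = sets (density D (\<lambda>_. ennreal (1 / V)))"
      by (simp add: normalized_sphere_measure_def sphere_surface_measure_def D_def)
    fix A assume "A \<in> sets (normalized_sphere_measure s :: 'a measure)"
    then have A: "A \<in> sets borel"
      by (simp add: normalized_sphere_measure_def sphere_surface_measure_def)
    have "?p -` (?S \<inter> A) \<inter> ?B = ?p -` A \<inter> ?B" using s by auto
    then have SA: "emeasure D (?S \<inter> A) = emeasure D A" using A by (simp add: DA)
    obtain m where m: "0 \<le> m" "emeasure D A = ennreal m"
      using D_finite[OF A] by (cases "emeasure D A") auto
    have "emeasure (normalized_sphere_measure s) A = (ennreal c * ennreal m) / (ennreal c * ennreal V)"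
      unfolding normalized_sphere_measure_def
      using A by (subst emeasure_uniform_measure)
        (simp_all add: sphere_surface_measure_def c_def D_def[symmetric] D_sets SA DS m)
    also have "\<dots> = ennreal (m / V)"
      using c m V_pos by (simp flip: ennreal_mult add: divide_ennreal)
    also have "\<dots> = emeasure (density D (\<lambda>_. ennreal (1 / V))) A"
      using A m V_pos by (simp add: emeasure_density_const D_sets flip: ennreal_mult)
    finally show "emeasure (normalized_sphere_measure s) A = emeasure (density D (\<lambda>_. ennreal (1 / V))) A" .
  qed
  then have "integral\<^sup>L (normalized_sphere_measure s) F = integral\<^sup>L (density D (\<lambda>_. ennreal (1 / V))) F"
    by simp
  also have "\<dots> = integral\<^sup>L D (\<lambda>w. (1 / V) *\<^sub>R F w)"
    using F V_pos by (intro integral_density) (auto simp: D_def)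
  also have "\<dots> = (1 / V) *\<^sub>R integral\<^sup>L D F" by simp
  also have "integral\<^sup>L D F = integral\<^sup>L (restrict_space lborel ?B) (\<lambda>w. F (?p w))"
    unfolding D_def by (rule integral_distr[OF p_meas F])
  also have "\<dots> = (LINT w:?B|lborel. F (?p w))"
    unfolding set_lebesgue_integral_def by (rule integral_restrict_space) simp
  finally show ?thesis by (simp add: V_def)
qed

lemma inner_complexify: "complexify x \<bullet> complexify y = x \<bullet> y"
  for x y :: "real ^ ('n::finite + 'n)"
proof -
  have "x \<bullet> y = (\<Sum>k\<in>UNIV <+> UNIV. x $ k * y $ k)"
    by (simp add: inner_vec_def)
  also have "\<dots> = (\<Sum>j\<in>UNIV. x $ Inl j * y $ Inl j) + (\<Sum>j\<in>UNIV. x $ Inr j * y $ Inr j)"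
    by (subst sum.Plus) simp_all
  finally show ?thesis
    by (simp add: inner_vec_def complexify_def inner_complex_def sum.distrib)
qed

lemma Re_cdot_cnj: "Re (cdot z (vec_cnj w)) = z \<bullet> w"
  by (simp add: cdot_def vec_cnj_def inner_vec_def inner_complex_def)

lemma linear_complexify: "linear complexify"
  by (rule linearI) (auto simp: complexify_def vec_eq_iff complex_eq_iff)

lemma linear_realify: "linear realify"
  by (rule linearI) (auto simp: realify_def vec_eq_iff split: sum.split)

text \<open>Dividing by \<open>|\<lambda>|\<close> makes the square of this map \<open>-1\<close>, whatever \<open>\<lambda> \<noteq> 0\<close> is.\<close>

definition htype_complex_structure ::
  "('m::finite \<Rightarrow> real ^ ('n::finite + 'n) ^ ('n + 'n)) \<Rightarrow> real ^ 'm \<Rightarrow> complex ^ 'n \<Rightarrow> complex ^ 'n"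
  where "htype_complex_structure U lam w = (1 / norm lam) *\<^sub>R (\<Sum>j\<in>UNIV. lam $ j *\<^sub>R complex_action (U j) w)"

lemma htype_complex_structure_inner:
  assumes "lam \<noteq> 0"
  shows "norm lam * (z \<bullet> htype_complex_structure U lam w) =
    (\<Sum>j\<in>UNIV. lam $ j * Re (cdot z (vec_cnj (complex_action (U j) w))))"
  using assms by (simp add: htype_complex_structure_def inner_sum_right Re_cdot_cnj)

lemma linear_complex_action: "linear (complex_action U)"
  unfolding complex_action_def[abs_def]
  using linear_compose[OF linear_compose[OF linear_realify matrix_vector_mul_linear[of U]] linear_complexify]
  by (simp add: o_def)

lemma linear_htype_complex_structure: "linear (htype_complex_structure U lam)"
  unfolding htype_complex_structure_def[abs_def]
  by (intro linear_compose_scale_right linear_compose_sum ballI linear_complex_action)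

text \<open>In the square of \<open>\<Sum>\<^sub>j \<lambda>\<^sub>j U\<^sub>j\<close> the mixed terms cancel by anticommutation, and each \<open>U\<^sub>j\<close> squares to
  \<open>-1\<close>, so the square is \<open>-|\<lambda>|\<^sup>2\<close>.\<close>

lemma twisted_space_htype:
  fixes U :: "'m::finite \<Rightarrow> real ^ ('n::finite + 'n) ^ ('n + 'n)"
  assumes U: "htype_matrices U" and lam: "lam \<noteq> 0"
  shows "twisted_space (htype_complex_structure U lam) (norm lam / 2)"
proof (rule twisted_space.intro)
  let ?J = "htype_complex_structure U lam"
  let ?u = "\<lambda>j. complex_action (U j)"
  have skew: "transpose (U j) = - U j" and orth: "transpose (U j) ** U j = mat 1"
    and anti: "j \<noteq> l \<Longrightarrow> U j ** U l + U l ** U j = 0" for j l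
    using U unfolding htype_matrices_def orthogonal_matrix by blast+
  have minus: "(- A) *v x = - (A *v x)" for A :: "real ^ ('n + 'n) ^ ('n + 'n)" and x
    by (simp add: matrix_vector_mult_def vec_eq_iff sum_negf)
  have u_skew: "?u j x \<bullet> y = - (x \<bullet> ?u j y)" for j x y
  proof -
    have "x \<bullet> ?u j y = realify x \<bullet> (U j *v realify y)"
      unfolding complex_action_def by (metis complexify_realify inner_complexify)
    also have "\<dots> = (transpose (U j) *v realify x) \<bullet> realify y"
      by (simp add: dot_lmul_matrix transpose_matrix_vector)
    also have "\<dots> = - ((U j *v realify x) \<bullet> realify y)"
      by (simp add: skew minus)
    also have "(U j *v realify x) \<bullet> realify y = ?u j x \<bullet> y"
      unfolding complex_action_def by (metis complexify_realify inner_complexify)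
    finally show ?thesis by simp
  qed
  have u_comp: "?u j (?u l x) = complexify ((U j ** U l) *v realify x)" for j l x
    by (simp add: complex_action_def matrix_vector_mul_assoc)
  have u_square: "?u j (?u j x) = - x" for j x
  proof -
    have "(U j ** U j) *v realify x = - (- U j ** U j) *v realify x"
      by (simp add: matrix_vector_mul_assoc[symmetric] minus)
    also have "\<dots> = - realify x"
      using orth[of j] by (simp add: skew minus)
    finally show ?thesis using u_comp[of j j x] by (simp add: linear_neg[OF linear_complexify])
  qed
  have u_anti: "?u j (?u l x) + ?u l (?u j x) = 0" if "j \<noteq> l" for j l x
  proof -
    have "?u j (?u l x) + ?u l (?u j x) = complexify ((U j ** U l + U l ** U j) *v realify x)"
      by (simp add: u_comp matrix_vector_mult_add_rdistrib linear_add[OF linear_complexify])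
    then show ?thesis using anti[OF that] linear_0[OF linear_complexify] by simp
  qed
  show "linear ?J" by (rule linear_htype_complex_structure)
  show "?J x \<bullet> y = - (x \<bullet> ?J y)" for x y
    by (simp add: htype_complex_structure_def inner_sum_left inner_sum_right u_skew sum_negf)
  show "norm lam / 2 > 0" using lam by simp
  show "?J (?J x) = - x" for x
  proof -
    let ?T = "\<lambda>j l. (lam $ j * lam $ l) *\<^sub>R ?u j (?u l x)"
    have JJ: "?J (?J x) = (1 / (norm lam)\<^sup>2) *\<^sub>R (\<Sum>j\<in>UNIV. \<Sum>l\<in>UNIV. ?T j l)"
      by (simp add: htype_complex_structure_def linear_scale[OF linear_complex_action]
          linear_sum[OF linear_complex_action] scaleR_sum_right power2_eq_square mult_ac)
    have "(\<Sum>j\<in>UNIV. \<Sum>l\<in>UNIV. ?T j l) + (\<Sum>j\<in>UNIV. \<Sum>l\<in>UNIV. ?T j l) =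
        (\<Sum>j\<in>UNIV. \<Sum>l\<in>UNIV. ?T j l) + (\<Sum>l\<in>UNIV. \<Sum>j\<in>UNIV. ?T j l)"
      by (subst (4) sum.swap) simp
    also have "\<dots> = (\<Sum>j\<in>UNIV. \<Sum>l\<in>UNIV. (lam $ j * lam $ l) *\<^sub>R (?u j (?u l x) + ?u l (?u j x)))"
      by (simp add: sum.distrib scaleR_add_right mult.commute)
    also have "\<dots> = (\<Sum>j\<in>UNIV. \<Sum>l\<in>UNIV. if l = j then (- 2 * (lam $ j)\<^sup>2) *\<^sub>R x else 0)"
    proof (intro sum.cong refl)
      fix j l
      show "(lam $ j * lam $ l) *\<^sub>R (?u j (?u l x) + ?u l (?u j x)) =
        (if l = j then (- 2 * (lam $ j)\<^sup>2) *\<^sub>R x else 0)"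
      proof (cases "l = j")
        case True
        then show ?thesis
          by (simp add: u_square power2_eq_square vec_eq_iff scaleR_conv_of_real algebra_simps)
      next
        case False
        then show ?thesis using u_anti[of j l x] by simp
      qed
    qed
    also have "\<dots> = (- 2 * (norm lam)\<^sup>2) *\<^sub>R x"
    proof -
      have "(norm lam)\<^sup>2 = (\<Sum>j\<in>UNIV. (lam $ j)\<^sup>2)"
        unfolding power2_norm_eq_inner inner_vec_def by (simp add: power2_eq_square)
      then show ?thesis by (simp add: sum_distrib_left scaleR_sum_left sum_negf)
    qed
    finally have "2 *\<^sub>R (\<Sum>j\<in>UNIV. \<Sum>l\<in>UNIV. ?T j l) = 2 *\<^sub>R (- ((norm lam)\<^sup>2 *\<^sub>R x))"
      by (simp add: scaleR_2[symmetric])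
    then have "(\<Sum>j\<in>UNIV. \<Sum>l\<in>UNIV. ?T j l) = - ((norm lam)\<^sup>2 *\<^sub>R x)"
      by (simp only: scaleR_cancel_left) simp
    then show ?thesis using lam by (simp add: JJ)
  qed
qed

lemma twisted_spherical_mean_eq:
  fixes f :: "complex ^ 'n::finite \<Rightarrow> complex"
  assumes f: "continuous_on UNIV f" and lam: "lam \<noteq> 0" and s: "s > 0"
  shows "twisted_spherical_mean U lam f s z =
    (1 / measure lborel (ball (0::complex ^ 'n) 1)) *\<^sub>R
    (LINT w:ball 0 1 - {0}|lborel. f (z - (s / norm w) *\<^sub>R w) *
      cis (norm lam / 2 * (z \<bullet> htype_complex_structure U lam ((s / norm w) *\<^sub>R w))))"
proof -
  let ?J = "htype_complex_structure U lam"
  have phase: "exp (\<i> / 2 * complex_of_real (\<Sum>j\<in>UNIV. lam $ j * Re (cdot z (vec_cnj (complex_action (U j) w))))) =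
      cis (norm lam / 2 * (z \<bullet> ?J w))" for w
    unfolding htype_complex_structure_inner[OF lam, symmetric] cis_conv_exp by (simp add: mult.commute)
  have lin: "linear ?J" by (rule linear_htype_complex_structure)
  have "continuous_on UNIV (\<lambda>w. f (z - w) * cis (norm lam / 2 * (z \<bullet> ?J w)))"
    using lin by (intro continuous_intros continuous_on_compose2[OF f] linear_continuous_on linear_conv_bounded_linear[THEN iffD1]) auto
  then have "(\<lambda>w. f (z - w) * cis (norm lam / 2 * (z \<bullet> ?J w))) \<in> borel_measurable borel"
    by (rule borel_measurable_continuous_onI)
  from integral_normalized_sphere_measure[OF s this] show ?thesis
    unfolding twisted_spherical_mean_def phase .
qed

theorem theorem4p3:
  fixes G :: "((real ^ ('n::finite + 'n)) \<times> (real ^ 'm::finite)) monoid"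
    and U :: "'m \<Rightarrow> real ^ ('n + 'n) ^ ('n + 'n)"
    and lam :: "real ^ 'm"
    and r :: real
    and f :: "complex ^ 'n \<Rightarrow> complex"
  assumes "htype_group G U"
    and "lam \<noteq> 0"
    and "r \<ge> 0"
    and "continuous_on UNIV f"
    and "\<forall>k::nat. bounded (range (\<lambda>z.
           complex_of_real (norm z ^ k * exp (norm lam / 4 * (norm z)\<^sup>2)) * f z))"
  shows "closure {z. f z \<noteq> 0} \<subseteq> cball 0 r \<longleftrightarrow>
    (\<forall>z s. s > r + norm z \<longrightarrow> twisted_spherical_mean U lam f s z = 0)"
proof -
  let ?J = "htype_complex_structure U lam"
  have U: "htype_matrices U" using assms(1) by (simp add: htype_group_def)
  interpret twisted_space ?J "norm lam / 2"
    by (rule twisted_space_htype[OF U assms(2)])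
  have pos: "s > 0" if "s > r + norm z" for s and z :: "complex ^ 'n"
    using that assms(3) norm_ge_zero[of z] by linarith
  have f: "rapid f"
    unfolding rapid_def
  proof (intro conjI allI)
    fix k
    obtain C0 where C0: "\<And>z. norm (complex_of_real (norm z ^ 0 * exp (norm lam / 4 * (norm z)\<^sup>2)) * f z) \<le> C0"
      using assms(5)[rule_format, of 0] unfolding bounded_iff by blast
    obtain C where C: "\<And>z. norm (complex_of_real (norm z ^ k * exp (norm lam / 4 * (norm z)\<^sup>2)) * f z) \<le> C"
      using assms(5)[rule_format, of k] unfolding bounded_iff by blast
    have "norm (f u) * (1 + norm u) ^ k * exp (norm lam / 2 / 2 * (norm u)\<^sup>2) \<le> 2 ^ k * (C0 + C)" for u
    proof -
      define x where "x = norm u"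
      define E where "E = exp (norm lam / 4 * x\<^sup>2) * norm (f u)"
      have E: "0 \<le> E" "E \<le> C0" "x ^ k * E \<le> C"
        using C0[of u] C[of u] by (auto simp: E_def x_def norm_mult norm_power mult.assoc)
      have "(1 + x) ^ k \<le> (2 * max 1 x) ^ k"
        by (intro power_mono) (auto simp: x_def)
      also have "\<dots> \<le> 2 ^ k * (1 + x ^ k)"
        by (auto simp: max_def power_mult_distrib x_def)
      finally have "(1 + x) ^ k * E \<le> 2 ^ k * (1 + x ^ k) * E"
        using E by (intro mult_right_mono)
      also have "\<dots> = 2 ^ k * (E + x ^ k * E)" by (simp add: algebra_simps)
      also have "\<dots> \<le> 2 ^ k * (C0 + C)" using E by (intro mult_left_mono add_mono) auto
      finally show ?thesis by (simp add: E_def x_def mult_ac)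
    qed
    then show "\<exists>C. \<forall>u. norm (f u) * (1 + norm u) ^ k * exp (norm lam / 2 / 2 * (norm u)\<^sup>2) \<le> C"
      by blast
  qed (fact assms(4))
  note mean = twisted_spherical_mean_eq[OF assms(4) assms(2)]
  show ?thesis
  proof (intro iffI allI impI)
    fix z :: "complex ^ 'n" and s
    assume supp: "closure {z. f z \<noteq> 0} \<subseteq> cball 0 r" and s: "s > r + norm z"
    have "f (z - (s / norm w) *\<^sub>R w) = 0" if "w \<noteq> 0" for w
    proof (rule ccontr)
      assume "f (z - (s / norm w) *\<^sub>R w) \<noteq> 0"
      then have "norm (z - (s / norm w) *\<^sub>R w) \<le> r"
        using supp closure_subset[of "{z. f z \<noteq> 0}"] by (auto simp: subset_iff)
      moreover have "norm ((s / norm w) *\<^sub>R w) = s" using that pos[OF s] by simp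
      ultimately show False
        using s norm_triangle_ineq2[of "(s / norm w) *\<^sub>R w" z] by (simp add: norm_minus_commute)
    qed
    then have "(LINT w:ball 0 1 - {0}|lborel. f (z - (s / norm w) *\<^sub>R w) *
        cis (norm lam / 2 * (z \<bullet> ?J ((s / norm w) *\<^sub>R w)))) = (LINT w|(lborel :: (complex ^ 'n) measure). 0)"
      unfolding set_lebesgue_integral_def by (intro Bochner_Integration.integral_cong) (auto simp: indicator_def)
    then show "twisted_spherical_mean U lam f s z = 0"
      by (simp add: mean[OF pos[OF s]])
  next
    assume zero: "\<forall>z s. s > r + norm z \<longrightarrow> twisted_spherical_mean U lam f s z = 0"
    have "measure lborel (ball (0::complex ^ 'n) 1) \<noteq> 0"
      using content_ball_pos[of 1 "0 :: complex ^ 'n"] by simp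
    then have "(LINT w:ball 0 1 - {0}|lborel. f (z - (s / norm w) *\<^sub>R w) *
        cis (norm lam / 2 * (z \<bullet> ?J ((s / norm w) *\<^sub>R w)))) = 0" if "r + norm z < s" for z s
      using zero[rule_format, OF that] unfolding mean[OF pos[OF that]] by simp
    then have "exterior_null r f"
      by (rule exterior_null_if_spherical_means_zero[OF assms(3) f])
    then have "f x = 0" if "r < norm x" for x
      using vanishes_outside_ball[OF assms(3) f _ that] by blast
    then have "{z. f z \<noteq> 0} \<subseteq> cball 0 r" by (auto simp: not_less[symmetric])
    then show "closure {z. f z \<noteq> 0} \<subseteq> cball 0 r"
      by (rule closure_minimal) simp
  qed
qed

end
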